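(* Let $m:\mathbb{R}\to\mathbb{R}$ be a continuously differentiable function and $F\in\mathbb{L}_{m,\phi}$ a distribution function on (an interval of) $\mathbb{R}$ that has at most finitely many jumps and is otherwise continuously differentiable with strictly positive density $f$. Then the map $\phi\circ\psi:\mathbb{L}_{m,\phi}\to\mathbb{B}$, $\phi\circ\psi(F)=m(Q)$, where $Q=F^{-1}$, is Hadamard differentiable at $F$ tangentially to the set $\mathbb{L}_{m,0}$ of all continuous functions in $\mathbb{L}_m$. The derivative is given by $(\phi\circ\psi)_F'(z)=-(m'z/f)\circ Q$.
   Context: $\mathbb{L}_m$ is the space of Borel-measurable functions $z:\mathbb{R}\to\mathbb{R}$ with limits $z(\pm\infty)=\lim_{x\to\pm\infty}z(x)$ and the norm $\|z\|_{\mathbb{L}_m}=\bigl(\sup_{x\in\mathbb{R}}|z(x)|\bigr)\vee\bigl(\int_{-\infty}^\infty|\tilde z|\,|dm|\bigr)$, where $\tilde z(x)=z(x)-z(-\infty)\mathbf{1}\{x<0\}-z(+\infty)\mathbf{1}\{x\ge0\}$ and $|dm|$ is the total variation measure of the Lebesgue–Stieltjes measure of $m$ (just $dm$ if $m$ is nondecreasing). $\mathbb{L}_{m,\phi}\subset\mathbb{L}_m$ is the subset of monotone cadlag functions with $z(-\infty)=0$ and $z(+\infty)=1$. $\mathbb{B}$ is the space of ladcag (left-continuous with right limits) functions $z:(0,1)\to\mathbb{R}$ with the norm $\|z\|_{\mathbb{B}}=\int_0^1|z(u)|\,du$. The inverse of a nondecreasing function is $F^{-1}(u)=\inf\{x\in\mathbb{R}:F(x)\ge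 u\}$. The expression $-(m'z/f)\circ Q$ equals $-(m'\circ Q)(z\circ Q)Q'$; on the $u$-intervals corresponding to jumps of $F$ (where $Q$ is constant) it is understood to be $0$. A map $\Phi:\mathbb{D}_\Phi\subset\mathbb{D}\to\mathbb{E}$ between normed spaces is Hadamard differentiable at $\theta$ tangentially to $\mathbb{D}_0$ if there is a continuous linear map $\Phi'_\theta:\mathbb{D}_0\to\mathbb{E}$ with $\|(\Phi(\theta+t h_t)-\Phi(\theta))/t-\Phi'_\theta(h)\|_{\mathbb{E}}\to0$ as $t\to0$ for all $h_t\to h\in\mathbb{D}_0$ with $\theta+th_t\in\mathbb{D}_\Phi$.
   Formalization: Added: 1/f has finite one-sided limits at jumps of F (else the derivative need not be ladcag); for F on a proper interval, tangent functions z vanish off it; the derivative formula is asserted (a.e.) only for z making it integrable, which includes all z with z(±∞)=0. *)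

theory Defs
  imports "HOL-Analysis.Analysis"
begin

subsection \<open>The total variation measure of a function of locally bounded variation\<close>

definition total_variation :: "(real \<Rightarrow> real) \<Rightarrow> real \<Rightarrow> real \<Rightarrow> real" where
  "total_variation m a b =
     (SUP d\<in>{d. d division_of {a..b}}. \<Sum>k\<in>d. \<bar>m (Sup k) - m (Inf k)\<bar>)"

definition variation_fun :: "(real \<Rightarrow> real) \<Rightarrow> real \<Rightarrow> real" where
  "variation_fun m x = (if 0 \<le> x then total_variation m 0 x else - total_variation m x 0)"

text \<open>For right-continuous \<open>m\<close> of locally bounded variation, \<open>|dm|\<close> is the Lebesgue--Stieltjes
  measure of the (normalized) variation function of \<open>m\<close>, that is, \<open>|dm|\<close> of \<open>(a, b]\<close> is the total
  variation of \<open>m\<close> over \<open>[a, b]\<close>.  If \<open>m\<close> is nondecreasing, it is \<open>dm\<close>.\<close>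

definition abs_dm :: "(real \<Rightarrow> real) \<Rightarrow> real measure" where
  "abs_dm m = interval_measure (variation_fun m)"


subsection \<open>The function spaces\<close>

definition tilde :: "(real \<Rightarrow> real) \<Rightarrow> real \<Rightarrow> real" where
  "tilde z x = z x - Lim at_bot z * indicator {..<0} x - Lim at_top z * indicator {0..} x"

definition Lm :: "(real \<Rightarrow> real) \<Rightarrow> (real \<Rightarrow> real) set" where
  "Lm m = {z \<in> borel_measurable borel.
     (\<exists>l. (z \<longlongrightarrow> l) at_bot) \<and> (\<exists>l. (z \<longlongrightarrow> l) at_top) \<and>
     bounded (range z) \<and> integrable (abs_dm m) (tilde z)}"

definition Lm_norm :: "(real \<Rightarrow> real) \<Rightarrow> (real \<Rightarrow> real) \<Rightarrow> real" where
  "Lm_norm m z = max (SUP x. \<bar>z x\<bar>) (LINT x|abs_dm m. \<bar>tilde z x\<bar>)"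

definition Lm_phi :: "(real \<Rightarrow> real) \<Rightarrow> (real \<Rightarrow> real) set" where
  "Lm_phi m = {z \<in> Lm m. mono z \<and>
     (\<forall>x. (z \<longlongrightarrow> z x) (at_right x) \<and> (\<exists>l. (z \<longlongrightarrow> l) (at_left x))) \<and>
     (z \<longlongrightarrow> 0) at_bot \<and> (z \<longlongrightarrow> 1) at_top}"

definition Lm_0 :: "(real \<Rightarrow> real) \<Rightarrow> (real \<Rightarrow> real) set" where
  "Lm_0 m = {z \<in> Lm m. continuous_on UNIV z}"

text \<open>A function on \<open>(0, 1)\<close> is represented by its extension by \<open>0\<close> to the real line, so that equality
  of elements of \<open>\<bbbB>\<close> is equality of HOL functions.\<close>

definition BB :: "(real \<Rightarrow> real) set" where
  "BB = {z. (\<forall>u\<in>{0<..<1}. (z \<longlongrightarrow> z u) (at_left u) \<and> (\<exists>l. (z \<longlongrightarrow> l) (at_right u))) \<and>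
     (\<forall>u. u \<notin> {0<..<1} \<longrightarrow> z u = 0) \<and> set_integrable lborel {0<..<1} z}"

definition BB_norm :: "(real \<Rightarrow> real) \<Rightarrow> real" where
  "BB_norm z = (LINT u:{0<..<1}|lborel. \<bar>z u\<bar>)"


subsection \<open>Quantile functions and the map to be differentiated\<close>

definition quantile :: "(real \<Rightarrow> real) \<Rightarrow> real \<Rightarrow> real" where
  "quantile F u = Inf {x. u \<le> F x}"

definition phi_psi :: "(real \<Rightarrow> real) \<Rightarrow> (real \<Rightarrow> real) \<Rightarrow> real \<Rightarrow> real" where
  "phi_psi m F u = (if u \<in> {0<..<1} then m (quantile F u) else 0)"

text \<open>The expression \<open>-(m' z / f) \<circ> Q\<close> on \<open>(0, 1)\<close>, with value \<open>0\<close> on the intervals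
  \<open>[F(x-), F(x)]\<close> belonging to the jumps \<open>x\<close> of \<open>F\<close>; on such an interval \<open>Q = x\<close>.
  At \<open>u = F(x-)\<close> the value \<open>0\<close> is in general not the left limit, so an element of \<open>\<bbbB>\<close> can equal this
  expression only off these finitely many points; as it is left-continuous, equality almost
  everywhere determines it.\<close>

definition deriv_expr ::
  "(real \<Rightarrow> real) \<Rightarrow> (real \<Rightarrow> real) \<Rightarrow> (real \<Rightarrow> real) \<Rightarrow> (real \<Rightarrow> real) \<Rightarrow> real \<Rightarrow> real" where
  "deriv_expr F f m' z u =
     (if u \<in> {0<..<1} \<and> isCont F (quantile F u)
      then - (m' (quantile F u) * z (quantile F u) / f (quantile F u)) else 0)"


subsection \<open>Hadamard differentiability\<close>

text \<open>The normed spaces are a carrier set of functions \<open>X\<close> with norm \<open>nX\<close> and a carrier set \<open>Y\<close> with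
  norm \<open>nY\<close>, under pointwise operations.  The map \<open>\<Phi> : X\<^sub>\<Phi> \<rightarrow> Y\<close> has derivative \<open>\<Phi>'\<close> at \<open>\<theta>\<close>
  tangentially to \<open>X\<^sub>0\<close>.  The limit \<open>t \<rightarrow> 0\<close>, \<open>h\<^sub>t \<rightarrow> h\<close> is taken along arbitrary sequences: with a net
  indexed by all \<open>t\<close> near \<open>0\<close> the condition would miss directions that are admissible only for
  positive \<open>t\<close>.\<close>

definition has_hadamard_derivative ::
  "('a \<Rightarrow> real) set \<Rightarrow> (('a \<Rightarrow> real) \<Rightarrow> real) \<Rightarrow> ('b \<Rightarrow> real) set \<Rightarrow> (('b \<Rightarrow> real) \<Rightarrow> real) \<Rightarrow>
   ('a \<Rightarrow> real) set \<Rightarrow> (('a \<Rightarrow> real) \<Rightarrow> 'b \<Rightarrow> real) \<Rightarrow> ('a \<Rightarrow> real) \<Rightarrow>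
   ('a \<Rightarrow> real) set \<Rightarrow> (('a \<Rightarrow> real) \<Rightarrow> 'b \<Rightarrow> real) \<Rightarrow> bool" where
  "has_hadamard_derivative X nX Y nY X\<^sub>\<Phi> \<Phi> \<theta> X\<^sub>0 \<Phi>' \<longleftrightarrow>
     X\<^sub>\<Phi> \<subseteq> X \<and> \<theta> \<in> X\<^sub>\<Phi> \<and> X\<^sub>0 \<subseteq> X \<and> \<Phi> \<in> X\<^sub>\<Phi> \<rightarrow> Y \<and> \<Phi>' \<in> X\<^sub>0 \<rightarrow> Y \<and>
     (\<forall>g\<in>X\<^sub>0. \<forall>h\<in>X\<^sub>0. \<forall>a b.
        \<Phi>' (\<lambda>x. a * g x + b * h x) = (\<lambda>u. a * \<Phi>' g u + b * \<Phi>' h u)) \<and>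
     (\<forall>h\<in>X\<^sub>0. \<forall>g. (\<forall>n. g n \<in> X\<^sub>0) \<and> (\<lambda>n. nX (\<lambda>x. g n x - h x)) \<longlonglongrightarrow> 0 \<longrightarrow>
        (\<lambda>n. nY (\<lambda>u. \<Phi>' (g n) u - \<Phi>' h u)) \<longlonglongrightarrow> 0) \<and>
     (\<forall>h\<in>X\<^sub>0. \<forall>t g. (\<forall>n. t n \<noteq> 0) \<and> t \<longlonglongrightarrow> 0 \<and> (\<forall>n. g n \<in> X) \<and>
        (\<lambda>n. nX (\<lambda>x. g n x - h x)) \<longlonglongrightarrow> 0 \<and> (\<forall>n. (\<lambda>x. \<theta> x + t n * g n x) \<in> X\<^sub>\<Phi>) \<longrightarrow>
        (\<lambda>n. nY (\<lambda>u. (\<Phi> (\<lambda>x. \<theta> x + t n * g n x) u - \<Phi> \<theta> u) / t n - \<Phi>' h u)) \<longlonglongrightarrow> 0)"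

end

theory Submission
  imports Defs
begin

text \<open>Let \<open>Q\<close> and \<open>Q\<^sub>n\<close> be the quantile functions of \<open>F\<close> and \<open>F + t\<^sub>n g\<^sub>n\<close>, and let \<open>W' = |m'|\<close>, so that
  \<open>dW = |dm|\<close>.  The difference quotients \<open>(m(Q\<^sub>n) - m(Q)) / t\<^sub>n\<close> converge pointwise off finitely many
  \<open>u\<close>, and they are dominated by \<open>|W(Q\<^sub>n) - W(Q)| / |t\<^sub>n|\<close>.  By Fubini's theorem the integrals of these
  bounds are the integrals of \<open>|g\<^sub>n|\<close> with respect to \<open>|dm|\<close>, which converge to that of \<open>|h|\<close>; as \<open>h\<close>
  vanishes off \<open>I\<close>, this is by change of variables the integral of the pointwise limit
  \<open>|m' h / f| \<circ> Q\<close> of the bounds.  Dominated convergence with varying bounds then gives convergence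
  in \<open>L\<^sup>1\<close>.\<close>

section \<open>The total variation measure of a continuously differentiable function\<close>

text \<open>No fixed integrable majorant of the difference quotients is at hand, because the
  \<open>g n\<close> converge only in norm. The bounds therefore move with n, and their integrals
  must converge exactly to the integral of their pointwise limit. This is why m is replaced by the
  nondecreasing W: |W(b) - W(a)| is the integral of |m'| between a and b, so exchanging integrals
  gives an equality and not just an estimate. The vanishing of h off I prevents a loss of mass: the
  bounds would otherwise keep the integral of |m' h| off I, which their pointwise limit cannot see.
  A second obstacle is that the derivative has to map every tangent direction into
  \<open>BB\<close>, also those with nonzero limits at infinity, for which the formula need not be
  integrable. Difference quotients test only directions that vanish at both ends, since F and its
  perturbations share the limits 0 and 1. This leaves room to correct the formula by terms linear in
  the two limits.\<close>

lemma additive_division_1: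
  fixes W :: "real \<Rightarrow> real"
  assumes "a \<le> b" "d division_of {a..b}"
  shows "(\<Sum>K\<in>d. W (Sup K) - W (Inf K)) = W b - W a"
proof -
  \<comment> \<open>An operative function must be 0 on degenerate intervals, and the bounds of the
    empty set carry no meaning. Members of a division are nonempty, so the sum never meets this
    case.\<close>
  let ?f = "\<lambda>K::real set. if K = {} then 0 else W (interval_upperbound K) - W (interval_lowerbound K)"
  interpret operative_real plus 0 ?f
    rewrites "comm_monoid_set.F (+) 0 = sum"
    by standard[1] (auto simp add: sum_def)
  have "(\<Sum>K\<in>d. W (Sup K) - W (Inf K)) = (\<Sum>K\<in>d. ?f K)"
    using division_ofD(3)[OF assms(2)] by (intro sum.cong) auto
  then show ?thesis
    using division[OF assms(2)] assms(1) by simp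
qed

text \<open>W - m and W + m are nondecreasing, since |m'| - m' and |m'| + m' are
  nonnegative.\<close>

lemma abs_diff_le_absolute_antiderivative:
  fixes m W m' :: "real \<Rightarrow> real"
  assumes m: "\<And>x. (m has_real_derivative m' x) (at x)"
    and W: "\<And>x. (W has_real_derivative \<bar>m' x\<bar>) (at x)"
    and "u \<le> v"
  shows "\<bar>m v - m u\<bar> \<le> W v - W u"
proof -
  have "W u - m u \<le> W v - m v"
    using \<open>u \<le> v\<close>
  proof (rule DERIV_nonneg_imp_nondecreasing)
    show "\<exists>y. ((\<lambda>x. W x - m x) has_real_derivative y) (at x) \<and> 0 \<le> y" for x
      by (rule exI[of _ "\<bar>m' x\<bar> - m' x"]) (auto intro!: derivative_eq_intros m W)
  qed
  moreover have "W u + m u \<le> W v + m v"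
    using \<open>u \<le> v\<close>
  proof (rule DERIV_nonneg_imp_nondecreasing)
    show "\<exists>y. ((\<lambda>x. W x + m x) has_real_derivative y) (at x) \<and> 0 \<le> y" for x
      by (rule exI[of _ "\<bar>m' x\<bar> + m' x"]) (auto intro!: derivative_eq_intros m W)
  qed
  ultimately show ?thesis by linarith
qed

text \<open>As x lies between u and v, the errors e (x - u) and e (v - x) of the two linear
  approximations at x add up to exactly e (v - u).\<close>

lemma derivative_straddle:
  fixes g :: "real \<Rightarrow> real"
  assumes "(g has_real_derivative D) (at x)" "0 < e"
  shows "\<exists>d>0. \<forall>u v. x - d < u \<longrightarrow> u \<le> x \<longrightarrow> x \<le> v \<longrightarrow> v < x + d \<longrightarrow>
    \<bar>g v - g u - D * (v - u)\<bar> \<le> e * (v - u)"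
proof -
  from assms obtain d where d: "d > 0"
    "\<And>y. norm (y - x) < d \<Longrightarrow> norm (g y - g x - D * (y - x)) \<le> e * norm (y - x)"
    unfolding has_field_derivative_def has_derivative_at_alt by blast
  have "\<bar>g v - g u - D * (v - u)\<bar> \<le> e * (v - u)" if "x - d < u" "u \<le> x" "x \<le> v" "v < x + d" for u v
  proof -
    have "\<bar>g u - g x - D * (u - x)\<bar> \<le> e * (x - u)" "\<bar>g v - g x - D * (v - x)\<bar> \<le> e * (v - x)"
      using d(2)[of u] d(2)[of v] that by auto
    moreover have "g v - g u - D * (v - u) = (g v - g x - D * (v - x)) - (g u - g x - D * (u - x))"
      "e * (v - u) = e * (v - x) + e * (x - u)"
      by (simp_all add: algebra_simps)
    ultimately show ?thesis by linarith
  qed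
  with d(1) show ?thesis by blast
qed

text \<open>The upper bound holds interval by interval. For the lower bound, on a short interval
  around a tag x the increments of m and W are close to m'(x) (v - u) and |m'(x)| (v - u), numbers
  of equal modulus. Each approximation costs e (v - u), hence the factor 2 in
  \<open>lower\<close>.\<close>

lemma total_variation_eq_antiderivative:
  fixes m W m' :: "real \<Rightarrow> real"
  assumes m: "\<And>x. (m has_real_derivative m' x) (at x)"
    and W: "\<And>x. (W has_real_derivative \<bar>m' x\<bar>) (at x)"
    and ab: "a \<le> b"
  shows "total_variation m a b = W b - W a"
proof -
  let ?S = "\<lambda>d. \<Sum>k\<in>d. \<bar>m (Sup k) - m (Inf k)\<bar>"
  have le_k: "Inf k \<le> Sup k" if "d division_of {a..b}" "k \<in> d" for d k
    using division_ofD(3,4)[OF that] by force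
  have upper: "?S d \<le> W b - W a" if d: "d division_of {a..b}" for d
  proof -
    have "?S d \<le> (\<Sum>k\<in>d. W (Sup k) - W (Inf k))"
      by (intro sum_mono abs_diff_le_absolute_antiderivative[OF m W] le_k[OF d])
    also have "\<dots> = W b - W a" by (rule additive_division_1[OF ab d])
    finally show ?thesis .
  qed
  have lower: "\<exists>d. d division_of {a..b} \<and> W b - W a - 2 * e * (b - a) \<le> ?S d" if e: "e > 0" for e
  proof -
    have "\<exists>d>0. \<forall>u v. x - d < u \<longrightarrow> u \<le> x \<longrightarrow> x \<le> v \<longrightarrow> v < x + d \<longrightarrow>
      W v - W u - 2 * e * (v - u) \<le> \<bar>m v - m u\<bar>" for x
    proof -
      from derivative_straddle[OF m e] obtain d1 where d1: "d1 > 0"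
        "\<forall>u v. x - d1 < u \<longrightarrow> u \<le> x \<longrightarrow> x \<le> v \<longrightarrow> v < x + d1 \<longrightarrow>
          \<bar>m v - m u - m' x * (v - u)\<bar> \<le> e * (v - u)" by blast
      from derivative_straddle[OF W e] obtain d2 where d2: "d2 > 0"
        "\<forall>u v. x - d2 < u \<longrightarrow> u \<le> x \<longrightarrow> x \<le> v \<longrightarrow> v < x + d2 \<longrightarrow>
          \<bar>W v - W u - \<bar>m' x\<bar> * (v - u)\<bar> \<le> e * (v - u)" by blast
      have "W v - W u - 2 * e * (v - u) \<le> \<bar>m v - m u\<bar>"
        if "x - min d1 d2 < u" "u \<le> x" "x \<le> v" "v < x + min d1 d2" for u v
      proof -
        have "\<bar>m v - m u - m' x * (v - u)\<bar> \<le> e * (v - u)"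
          "\<bar>W v - W u - \<bar>m' x\<bar> * (v - u)\<bar> \<le> e * (v - u)"
          using that d1(2) d2(2) by auto
        moreover have "\<bar>m' x * (v - u)\<bar> = \<bar>m' x\<bar> * (v - u)"
          using that by (simp add: abs_mult)
        ultimately show ?thesis by linarith
      qed
      then show ?thesis using d1(1) d2(1) by (intro exI[of _ "min d1 d2"]) auto
    qed
    then obtain r where r: "\<And>x. r x > 0"
      "\<And>x u v. x - r x < u \<Longrightarrow> u \<le> x \<Longrightarrow> x \<le> v \<Longrightarrow> v < x + r x \<Longrightarrow>
        W v - W u - 2 * e * (v - u) \<le> \<bar>m v - m u\<bar>" by metis
    \<comment> \<open>The admissible radius depends on the tag without any uniformity, so the
      division comes from Cousin's lemma for this gauge.\<close>
    have "gauge (\<lambda>x. ball x (r x))" using r(1) by (simp add: gauge_ball_dependent)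
    then obtain p where p: "p tagged_division_of {a..b}" "(\<lambda>x. ball x (r x)) fine p"
      by (rule fine_division_exists_real)
    define d where "d = snd ` p"
    have d: "d division_of {a..b}" unfolding d_def by (rule division_of_tagged_division[OF p(1)])
    have "W (Sup k) - W (Inf k) - 2 * e * (Sup k - Inf k) \<le> \<bar>m (Sup k) - m (Inf k)\<bar>" if "k \<in> d" for k
    proof -
      from that obtain x where xk: "(x, k) \<in> p" unfolding d_def by auto
      from tagged_division_ofD(2,4)[OF p(1) xk] obtain u v where k: "k = {u..v}" "x \<in> k" by auto
      then have uv: "u \<le> x" "x \<le> v" by auto
      have "k \<subseteq> ball x (r x)" using fineD[OF p(2) xk] .
      moreover have "u \<in> k" "v \<in> k" using k(1) uv by simp_all
      ultimately have "u \<in> ball x (r x)" "v \<in> ball x (r x)" by blast+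
      then have "W v - W u - 2 * e * (v - u) \<le> \<bar>m v - m u\<bar>"
        using uv by (intro r(2)[of x]) (auto simp: dist_real_def)
      moreover have "Sup k = v" "Inf k = u" using k uv by auto
      ultimately show ?thesis by simp
    qed
    then have "(\<Sum>k\<in>d. W (Sup k) - W (Inf k) - 2 * e * (Sup k - Inf k)) \<le> ?S d"
      by (rule sum_mono)
    moreover have "(\<Sum>k\<in>d. W (Sup k) - W (Inf k) - 2 * e * (Sup k - Inf k)) = W b - W a - 2 * e * (b - a)"
      using additive_division_1[OF ab d, of W] additive_division_1[OF ab d, of "\<lambda>x. x"]
      by (simp add: sum_subtractf sum_distrib_left[symmetric])
    ultimately show ?thesis using d by auto
  qed
  have bdd: "bdd_above (?S ` {d. d division_of {a..b}})"
    using upper by (intro bdd_aboveI[of _ "W b - W a"]) auto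
  show ?thesis unfolding total_variation_def
  proof (rule antisym)
    obtain d where "d division_of {a..b}" using lower[of 1] by auto
    then show "(SUP d\<in>{d. d division_of {a..b}}. ?S d) \<le> W b - W a"
      using upper by (intro cSUP_least) auto
    show "W b - W a \<le> (SUP d\<in>{d. d division_of {a..b}}. ?S d)"
    proof (rule field_le_epsilon)
      fix e :: real assume e: "e > 0"
      \<comment> \<open>The summand 1 keeps the denominator positive when a = b.\<close>
      define e' where "e' = e / (2 * (b - a) + 1)"
      have e': "e' > 0" "2 * e' * (b - a) \<le> e"
        using e ab by (auto simp: e'_def field_simps)
      from lower[OF e'(1)] obtain d where d: "d division_of {a..b}"
        "W b - W a - 2 * e' * (b - a) \<le> ?S d" by auto
      have "?S d \<le> (SUP d\<in>{d. d division_of {a..b}}. ?S d)"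
        using d(1) bdd by (intro cSUP_upper) auto
      with d(2) e'(2) show "W b - W a \<le> (SUP d\<in>{d. d division_of {a..b}}. ?S d) + e" by linarith
    qed
  qed
qed

text \<open>On half-open intervals, a generator stable under intersection, both measures are W b - W
  a: one by construction, the other by the fundamental theorem of calculus.\<close>

lemma interval_measure_eq_density:
  fixes W w :: "real \<Rightarrow> real"
  assumes [measurable]: "w \<in> borel_measurable borel"
    and W: "\<And>x. (W has_real_derivative w x) (at x)" and w: "\<And>x. 0 \<le> w x"
  shows "interval_measure W = density lborel (\<lambda>x. ennreal (w x))"
proof (rule measure_eqI_generator_eq)
  let ?E = "range (\<lambda>(a, b). {a<..b::real})"
  have mono: "W x \<le> W y" if "x \<le> y" for x y
    using that W w by (intro DERIV_nonneg_imp_nondecreasing[of x y W]) auto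
  have cont: "continuous (at_right a) W" for a
    using DERIV_isCont[OF W[of a]] by (simp add: continuous_at_imp_continuous_at_within)
  show "Int_stable ?E"
    by (auto simp: Int_stable_def image_iff)
  show "?E \<subseteq> Pow UNIV" by auto
  show "sets (interval_measure W) = sigma_sets UNIV ?E"
    "sets (density lborel (\<lambda>x. ennreal (w x))) = sigma_sets UNIV ?E"
    by (simp_all add: borel_sigma_sets_Ioc)
  show "range (\<lambda>i::nat. {-real i<..real i}) \<subseteq> ?E" by auto
  show "(\<Union>i::nat. {-real i<..real i}) = UNIV"
  proof -
    have "\<exists>i::nat. -real i < x \<and> x \<le> real i" for x
      using reals_Archimedean2[of "\<bar>x\<bar>"] by (metis abs_less_iff less_eq_real_def minus_less_iff)
    then show ?thesis by auto
  qed
  have eq: "emeasure (interval_measure W) {a<..b} = ennreal (W b - W a)" if "a \<le> b" for a b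
    using that mono cont by (rule emeasure_interval_measure_Ioc)
  show "emeasure (interval_measure W) {-real i<..real i} \<noteq> \<infinity>" for i :: nat
    by (simp add: eq)
  fix X assume "X \<in> ?E"
  then obtain a b where X: "X = {a<..b}" by auto
  show "emeasure (interval_measure W) X = emeasure (density lborel (\<lambda>x. ennreal (w x))) X"
  proof (cases "a \<le> b")
    case True
    have "emeasure (density lborel (\<lambda>x. ennreal (w x))) {a<..b} =
        (\<integral>\<^sup>+x. ennreal (w x) * indicator {a<..b} x \<partial>lborel)"
      by (simp add: emeasure_density)
    also have "\<dots> = (\<integral>\<^sup>+x. ennreal (w x) * indicator {a..b} x \<partial>lborel)"
      by (intro nn_integral_cong_AE AE_I[where N="{a}"]) (auto split: split_indicator)
    also have "\<dots> = W b - W a"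
      using True W w by (intro nn_integral_FTC_Icc) auto
    finally show ?thesis using eq[OF True] X by simp
  next
    case False
    then show ?thesis using X by simp
  qed
qed

lemma variation_fun_eq_antiderivative:
  fixes m W m' :: "real \<Rightarrow> real"
  assumes "\<And>x. (m has_real_derivative m' x) (at x)"
    and "\<And>x. (W has_real_derivative \<bar>m' x\<bar>) (at x)"
  shows "variation_fun m x = W x - W 0"
  using total_variation_eq_antiderivative[OF assms] by (auto simp: variation_fun_def)

lemma abs_dm_eq_density:
  fixes m W m' :: "real \<Rightarrow> real"
  assumes m: "\<And>x. (m has_real_derivative m' x) (at x)"
    and W: "\<And>x. (W has_real_derivative \<bar>m' x\<bar>) (at x)"
    and [measurable]: "m' \<in> borel_measurable borel"
  shows "abs_dm m = density lborel (\<lambda>x. ennreal \<bar>m' x\<bar>)"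
proof -
  have "variation_fun m = (\<lambda>x. W x - W 0)"
    using variation_fun_eq_antiderivative[OF m W] by auto
  then show ?thesis unfolding abs_dm_def
    by (simp, intro interval_measure_eq_density) (auto intro!: derivative_eq_intros W)
qed

lemma antiderivative_on_real_line:
  fixes g :: "real \<Rightarrow> real"
  assumes "continuous_on UNIV g"
  obtains W where "\<And>x. (W has_real_derivative g x) (at x)"
proof -
  have "\<exists>W. \<forall>x::real. -\<infinity> < ereal x \<longrightarrow> ereal x < \<infinity> \<longrightarrow> (W has_vector_derivative g x) (at x)"
    using assms by (intro einterval_antiderivative) (auto simp: continuous_on_eq_continuous_at)
  then show ?thesis
    using that by (auto simp: has_real_derivative_iff_has_vector_derivative)
qed

section \<open>Dominated convergence with varying bounds\<close>

text \<open>Only the part of |X n - X'| that exceeds Y n - Y' is handled by the usual theorem; the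
  integral of Y n - Y' tends to 0 by \<open>int_lim\<close>.\<close>

lemma dominated_convergence_varying_bound:
  fixes X :: "nat \<Rightarrow> 'a \<Rightarrow> real"
  assumes [measurable]: "\<And>n. X n \<in> borel_measurable M" "X' \<in> borel_measurable M"
    and Y: "\<And>n. integrable M (Y n)" and Y': "integrable M Y'"
    and bound: "\<And>n. AE x in M. \<bar>X n x\<bar> \<le> Y n x"
    and X_lim: "AE x in M. (\<lambda>n. X n x) \<longlonglongrightarrow> X' x"
    and Y_lim: "AE x in M. (\<lambda>n. Y n x) \<longlonglongrightarrow> Y' x"
    and int_lim: "(\<lambda>n. \<integral>x. Y n x \<partial>M) \<longlonglongrightarrow> (\<integral>x. Y' x \<partial>M)"
  shows "(\<lambda>n. \<integral>x. \<bar>X n x - X' x\<bar> \<partial>M) \<longlonglongrightarrow> 0"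
proof -
  have [measurable]: "\<And>n. Y n \<in> borel_measurable M" "Y' \<in> borel_measurable M"
    using Y Y' by auto
  have bound_all: "AE x in M. \<forall>n. \<bar>X n x\<bar> \<le> Y n x" using bound by (simp add: AE_all_countable)
  have bound': "AE x in M. \<bar>X' x\<bar> \<le> Y' x"
    using bound_all X_lim Y_lim
  proof eventually_elim
    case (elim x)
    show ?case
      using tendsto_rabs[OF elim(2)] elim(3) by (rule LIMSEQ_le) (use elim(1) in auto)
  qed
  \<comment> \<open>From |X n - X'| <= Y n + Y', subtracting Y n - Y' leaves at most 2 Y', a bound
    free of n. The truncation at 0 supplies the lower bound.\<close>
  define Z where "Z n x = max 0 (\<bar>X n x - X' x\<bar> - (Y n x - Y' x))" for n x
  have [measurable]: "Z n \<in> borel_measurable M" for n unfolding Z_def by measurable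
  have Zb: "AE x in M. norm (Z n x) \<le> 2 * Y' x" for n
    using bound[of n] bound' by eventually_elim (auto simp: Z_def)
  have Zlim: "AE x in M. (\<lambda>n. Z n x) \<longlonglongrightarrow> 0"
    using X_lim Y_lim
  proof eventually_elim
    case (elim x)
    have "(\<lambda>n. Z n x) \<longlonglongrightarrow> max 0 (\<bar>X' x - X' x\<bar> - (Y' x - Y' x))"
      unfolding Z_def by (intro tendsto_intros elim)
    then show ?case by simp
  qed
  have Y2: "integrable M (\<lambda>x. 2 * Y' x)" using Y' by simp
  \<comment> \<open>Applied to a constant sequence, the convergence theorem just turns measurability
    and domination into integrability.\<close>
  have Zint: "integrable M (Z n)" for n
    by (rule integrable_dominated_convergence2[where s="\<lambda>_. Z n" and f="Z n" and w="\<lambda>x. 2 * Y' x"])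
      (use Zb Y2 in auto)
  have "(\<lambda>n. \<integral>x. Z n x \<partial>M) \<longlonglongrightarrow> (\<integral>x. 0 \<partial>M)"
    by (rule integral_dominated_convergence[where w="\<lambda>x. 2 * Y' x"]) (use Zb Zlim Y2 in auto)
  then have "(\<lambda>n. (\<integral>x. Z n x \<partial>M) + ((\<integral>x. Y n x \<partial>M) - (\<integral>x. Y' x \<partial>M))) \<longlonglongrightarrow> 0 + ((\<integral>x. Y' x \<partial>M) - (\<integral>x. Y' x \<partial>M))"
    by (intro tendsto_intros int_lim) simp
  then have lim: "(\<lambda>n. (\<integral>x. Z n x \<partial>M) + ((\<integral>x. Y n x \<partial>M) - (\<integral>x. Y' x \<partial>M))) \<longlonglongrightarrow> 0" by simp
  have le: "(\<integral>x. \<bar>X n x - X' x\<bar> \<partial>M) \<le> (\<integral>x. Z n x \<partial>M) + ((\<integral>x. Y n x \<partial>M) - (\<integral>x. Y' x \<partial>M))" for n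
  proof -
    have "(\<integral>x. \<bar>X n x - X' x\<bar> \<partial>M) \<le> (\<integral>x. Z n x + (Y n x - Y' x) \<partial>M)"
    proof (rule integral_mono_AE')
      show "integrable M (\<lambda>x. Z n x + (Y n x - Y' x))"
        using Zint Y Y' by auto
      show "AE x in M. \<bar>X n x - X' x\<bar> \<le> Z n x + (Y n x - Y' x)"
        by (auto simp: Z_def)
      show "AE x in M. 0 \<le> Z n x + (Y n x - Y' x)"
        by (auto simp: Z_def)
    qed
    also have "\<dots> = (\<integral>x. Z n x \<partial>M) + ((\<integral>x. Y n x \<partial>M) - (\<integral>x. Y' x \<partial>M))"
      using Zint Y Y' by simp
    finally show ?thesis .
  qed
  show ?thesis
    by (rule tendsto_sandwich[OF _ _ tendsto_const lim]) (use le in auto)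
qed

section \<open>Quantile functions\<close>

lemma eventually_at_left_unit: "0 < u \<Longrightarrow> u < 1 \<Longrightarrow> eventually (\<lambda>v. 0 < v \<and> v < u) (at_left (u::real))"
  by (metis (mono_tags, lifting) eventually_at_left_real eventually_mono greaterThanLessThan_iff)

lemma eventually_at_right_unit: "0 < u \<Longrightarrow> u < 1 \<Longrightarrow> eventually (\<lambda>v. u < v \<and> v < 1) (at_right (u::real))"
  by (metis (mono_tags, lifting) eventually_at_right_real eventually_mono greaterThanLessThan_iff)

lemma unit_at_left: "0 < u \<Longrightarrow> u < 1 \<Longrightarrow> eventually (\<lambda>v::real. 0 < v \<and> v < 1) (at_left u)"
  by (rule eventually_mono[OF eventually_at_left_unit]) auto

lemma unit_at_right: "0 < u \<Longrightarrow> u < 1 \<Longrightarrow> eventually (\<lambda>v::real. 0 < v \<and> v < 1) (at_right u)"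
  by (rule eventually_mono[OF eventually_at_right_unit]) auto

locale distribution_function =
  fixes F :: "real \<Rightarrow> real"
  assumes F_mono: "mono F"
    and F_right: "\<And>x. (F \<longlongrightarrow> F x) (at_right x)"
    and F_bot: "(F \<longlongrightarrow> 0) at_bot"
    and F_top: "(F \<longlongrightarrow> 1) at_top"
begin

lemma F_nonneg: "0 \<le> F x"
proof (rule tendsto_upperbound[OF F_bot])
  show "eventually (\<lambda>y. F y \<le> F x) at_bot"
    using eventually_le_at_bot[of x] by eventually_elim (auto intro: monoD[OF F_mono])
qed simp

lemma F_le_1: "F x \<le> 1"
proof (rule tendsto_lowerbound[OF F_top])
  show "eventually (\<lambda>y. F x \<le> F y) at_top"
    using eventually_ge_at_top[of x] by eventually_elim (auto intro: monoD[OF F_mono])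
qed simp

lemma F_measurable [measurable]: "F \<in> borel_measurable borel"
  by (rule borel_measurable_mono[OF F_mono])

text \<open>The infimum is attained: the set is nonempty because F tends to 1 > u, bounded below
  because F tends to 0 < u, and right continuity puts the infimum into it. Most later facts on
  quantiles are read off from this Galois connection.\<close>

lemma quantile_le_iff:
  assumes u: "0 < u" "u < 1"
  shows "quantile F u \<le> x \<longleftrightarrow> u \<le> F x"
proof -
  let ?S = "{x. u \<le> F x}"
  from order_tendstoD(1)[OF F_top u(2)] obtain y where "u < F y"
    by (auto simp: eventually_at_top_linorder)
  then have ne: "?S \<noteq> {}" by (auto intro: less_imp_le)
  from order_tendstoD(2)[OF F_bot u(1)] obtain N where "\<And>y. y \<le> N \<Longrightarrow> F y < u"
    by (auto simp: eventually_at_bot_linorder)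
  then have bdd: "bdd_below ?S"
    by (intro bdd_belowI[of _ N]) (metis linorder_le_cases mem_Collect_eq not_less)
  have "u \<le> F (Inf ?S)"
  proof (rule tendsto_lowerbound[OF F_right])
    show "eventually (\<lambda>y. u \<le> F y) (at_right (Inf ?S))"
      unfolding eventually_at_filter
    proof (rule always_eventually, intro allI impI)
      fix y assume "y \<noteq> Inf ?S" "y \<in> {Inf ?S<..}"
      then obtain z where "z \<in> ?S" "z < y" using cInf_lessD[OF ne, of y] by auto
      then show "u \<le> F y" using monoD[OF F_mono, of z y] by auto
    qed
  qed simp
  then have "u \<le> F x" if "Inf ?S \<le> x"
    using monoD[OF F_mono that] by linarith
  then show ?thesis
    unfolding quantile_def using cInf_lower[OF _ bdd] by auto
qed

lemma less_quantile_iff: "0 < u \<Longrightarrow> u < 1 \<Longrightarrow> x < quantile F u \<longleftrightarrow> F x < u"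
  using quantile_le_iff[of u x] by linarith

lemma le_F_quantile: "0 < u \<Longrightarrow> u < 1 \<Longrightarrow> u \<le> F (quantile F u)"
  using quantile_le_iff[of u "quantile F u"] by simp

lemma quantile_mono: "0 < u \<Longrightarrow> u \<le> v \<Longrightarrow> v < 1 \<Longrightarrow> quantile F u \<le> quantile F v"
  using quantile_le_iff[of u "quantile F v"] le_F_quantile[of v] by simp

lemma quantile_eqI:
  assumes "0 < u" "u < 1" "u \<le> F x" "\<And>y. y < x \<Longrightarrow> F y < u"
  shows "quantile F u = x"
proof (rule antisym)
  show "quantile F u \<le> x" using quantile_le_iff assms by auto
  show "x \<le> quantile F u"
    using assms(4)[of "quantile F u"] le_F_quantile[OF assms(1,2)] by linarith
qed

lemma quantile_tendsto_left:
  assumes u: "0 < u" "u < 1"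
  shows "(quantile F \<longlongrightarrow> quantile F u) (at_left u)"
proof (rule increasing_tendsto)
  show "eventually (\<lambda>v. quantile F v \<le> quantile F u) (at_left u)"
    using eventually_at_left_unit[OF u] by eventually_elim (use u quantile_mono in auto)
  fix x assume "x < quantile F u"
  then have "F x < u" using less_quantile_iff u by auto
  then have "eventually (\<lambda>v. F x < v) (at_left u)"
    by (metis (mono_tags, lifting) eventually_at_left_real eventually_mono greaterThanLessThan_iff)
  with eventually_at_left_unit[OF u] show "eventually (\<lambda>v. x < quantile F v) (at_left u)"
    by eventually_elim (use u less_quantile_iff in auto)
qed

text \<open>A jump of the quantile function just to the right of u would be a stretch on which F
  stays at level u; \<open>inc\<close> rules this out.\<close>

lemma quantile_tendsto_right:
  assumes u: "0 < u" "u < 1" and inc: "\<And>y. quantile F u < y \<Longrightarrow> u < F y"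
  shows "(quantile F \<longlongrightarrow> quantile F u) (at_right u)"
proof (rule decreasing_tendsto)
  show "eventually (\<lambda>v. quantile F u \<le> quantile F v) (at_right u)"
    using eventually_at_right_unit[OF u] by eventually_elim (use u quantile_mono in auto)
  fix x assume "quantile F u < x"
  then obtain y where y: "quantile F u < y" "y < x" using dense by blast
  then have "u < F y" using inc by auto
  then have "eventually (\<lambda>v. v < F y) (at_right u)"
    by (metis (mono_tags, lifting) eventually_at_right_real eventually_mono greaterThanLessThan_iff)
  with eventually_at_right_unit[OF u] show "eventually (\<lambda>v. quantile F v < x) (at_right u)"
    proof eventually_elim
      case (elim v)
      then have "quantile F v \<le> y" using quantile_le_iff[of v y] u by simp
      then show ?case using y by simp
    qed
qed

lemma quantile_right_limit:
  assumes u: "0 < u" "u < 1"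
  shows "\<exists>l. (quantile F \<longlongrightarrow> l) (at_right u)"
proof
  let ?S = "quantile F ` {u<..<1}"
  have bdd: "bdd_below ?S" using u by (intro bdd_belowI[of _ "quantile F u"]) (auto intro: quantile_mono)
  have ne: "?S \<noteq> {}" using u by auto
  show "(quantile F \<longlongrightarrow> Inf ?S) (at_right u)"
  proof (rule decreasing_tendsto)
    show "eventually (\<lambda>v. Inf ?S \<le> quantile F v) (at_right u)"
      using eventually_at_right_unit[OF u] by eventually_elim (auto intro: cInf_lower bdd)
    fix x assume "Inf ?S < x"
    then obtain w where w: "u < w" "w < 1" "quantile F w < x"
      using cInf_lessD[OF ne, of x] by fastforce
    have "eventually (\<lambda>v. v < w) (at_right u)" using w
      by (metis (mono_tags, lifting) eventually_at_right_real eventually_mono greaterThanLessThan_iff)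
    with eventually_at_right_unit[OF u] show "eventually (\<lambda>v. quantile F v < x) (at_right u)"
      proof eventually_elim
      case (elim v)
      then have "quantile F v \<le> quantile F w" using u w by (intro quantile_mono) auto
      then show ?case using w by simp
    qed
  qed
qed

text \<open>Off (0,1) the set in \<open>quantile\<close> may be empty or unbounded below, where
  \<open>Inf\<close> has no useful value. The indicator confines the claim to the levels at which
  monotonicity is available.\<close>

lemma quantile_measurable:
  "(\<lambda>u. indicator {0<..<1} u * quantile F u) \<in> borel_measurable borel"
proof -
  have "mono_on {0<..<1} (quantile F)"
    by (auto simp: mono_on_def intro: quantile_mono)
  then have "quantile F \<in> borel_measurable (restrict_space borel {0<..<1})"
    by (rule borel_measurable_mono_on_fnc)
  then show ?thesis
    by (subst (asm) borel_measurable_restrict_space_iff) auto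
qed

lemma comp_quantile_measurable [measurable]:
  assumes [measurable]: "g \<in> borel_measurable borel"
  shows "(\<lambda>u. indicator {0<..<1} u * (g (quantile F u) :: real)) \<in> borel_measurable borel"
proof -
  note [measurable] = quantile_measurable
  have "(\<lambda>u. indicator {0<..<1} u * g (quantile F u)) =
    (\<lambda>u. indicator {0<..<1} u * g (indicator {0<..<1} u * quantile F u))"
    by (auto split: split_indicator)
  also have "\<dots> \<in> borel_measurable borel" by measurable
  finally show ?thesis .
qed

end

text \<open>Both sides integrate \<open>w x\<close> over the region of all \<open>(x, u)\<close> where exactly one of
  \<open>u \<le> F x\<close> and \<open>u \<le> G x\<close> holds.\<close>

lemma nn_integral_quantile_difference:
  fixes W w :: "real \<Rightarrow> real"
  assumes F: "distribution_function F" and G: "distribution_function G"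
    and [measurable]: "w \<in> borel_measurable borel"
    and W: "\<And>x. (W has_real_derivative w x) (at x)" and w: "\<And>x. 0 \<le> w x"
  shows "(\<integral>\<^sup>+u. indicator {0<..<1} u * ennreal \<bar>W (quantile G u) - W (quantile F u)\<bar> \<partial>lborel) =
    (\<integral>\<^sup>+x. ennreal (w x) * ennreal \<bar>G x - F x\<bar> \<partial>lborel)"
proof -
  interpret F: distribution_function F by fact
  interpret G: distribution_function G by fact
  let ?A = "\<lambda>x u. indicator {u. (u \<le> F x) \<noteq> (u \<le> G x)} u :: ennreal"
  have [measurable]: "Measurable.pred (lborel \<Otimes>\<^sub>M lborel) (\<lambda>x. snd x \<le> F (fst x))"
    "Measurable.pred (lborel \<Otimes>\<^sub>M lborel) (\<lambda>x. snd x \<le> G (fst x))" by measurable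
  have inner: "ennreal \<bar>W (quantile G u) - W (quantile F u)\<bar> = (\<integral>\<^sup>+x. ennreal (w x) * ?A x u \<partial>lborel)"
    if u: "0 < u" "u < 1" for u
  proof -
    have *: "ennreal (W b - W a) = (\<integral>\<^sup>+x. ennreal (w x) * indicator {a..<b} x \<partial>lborel)"
      if "a \<le> b" for a b
    proof -
      have "(\<integral>\<^sup>+x. ennreal (w x) * indicator {a..<b} x \<partial>lborel) =
          (\<integral>\<^sup>+x. ennreal (w x) * indicator {a..b} x \<partial>lborel)"
        by (intro nn_integral_cong_AE AE_I[where N="{b}"]) (auto split: split_indicator)
      also have "\<dots> = W b - W a"
        using that W w by (intro nn_integral_FTC_Icc) auto
      finally show ?thesis by simp
    qed
    have mono: "W a \<le> W b" if "a \<le> b" for a b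
      using that W w by (intro DERIV_nonneg_imp_nondecreasing[of a b W]) auto
    \<comment> \<open>By the Galois connection, for fixed u exactly one of the two inequalities
      holds iff x lies between the two quantiles. One of the two intervals on the right is always
      empty.\<close>
    have A: "?A x u = indicator {quantile F u..<quantile G u} x + indicator {quantile G u..<quantile F u} x" for x
      using F.quantile_le_iff[OF u, of x] G.quantile_le_iff[OF u, of x]
      by (auto split: split_indicator)
    show ?thesis
    proof (cases "quantile F u \<le> quantile G u")
      case True
      then show ?thesis using *[OF True] mono[OF True] unfolding A by simp
    next
      case False
      then have "quantile G u \<le> quantile F u" by simp
      then show ?thesis using *[of "quantile G u" "quantile F u"] mono[of "quantile G u" "quantile F u"]
        unfolding A by (simp add: abs_minus_commute)
    qed
  qed
  have outer: "(\<integral>\<^sup>+u. indicator {0<..<1} u * ?A x u \<partial>lborel) = ennreal \<bar>G x - F x\<bar>" for x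
  proof -
    \<comment> \<open>The half-open interval contains 1 if the larger of two distinct values is 1,
      while the left-hand side omits it; hence equality only up to the null set {1}.\<close>
    have "(\<integral>\<^sup>+u. indicator {0<..<1} u * ?A x u \<partial>lborel) =
        (\<integral>\<^sup>+u. indicator {min (F x) (G x)<..max (F x) (G x)} u \<partial>lborel)"
      using F.F_nonneg[of x] F.F_le_1[of x] G.F_nonneg[of x] G.F_le_1[of x]
      by (intro nn_integral_cong_AE AE_I[where N="{1}"]) (auto split: split_indicator)
    also have "\<dots> = ennreal \<bar>G x - F x\<bar>"
      by (auto simp: min_def max_def)
    finally show ?thesis .
  qed
  have "(\<integral>\<^sup>+u. indicator {0<..<1} u * ennreal \<bar>W (quantile G u) - W (quantile F u)\<bar> \<partial>lborel) =
      (\<integral>\<^sup>+u. \<integral>\<^sup>+x. indicator {0<..<1} u * (ennreal (w x) * ?A x u) \<partial>lborel \<partial>lborel)"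
    by (intro nn_integral_cong) (auto split: split_indicator simp: inner)
  also have "\<dots> = (\<integral>\<^sup>+x. \<integral>\<^sup>+u. indicator {0<..<1} u * (ennreal (w x) * ?A x u) \<partial>lborel \<partial>lborel)"
  proof (rule lborel_pair.Fubini')
    have "(\<lambda>p. indicator {0<..<1} (snd p) * (ennreal (w (fst p)) *
        indicator {p. (snd p \<le> F (fst p)) \<noteq> (snd p \<le> G (fst p))} p))
      \<in> borel_measurable (lborel \<Otimes>\<^sub>M lborel)"
      by measurable
    also have "(\<lambda>p. indicator {0<..<1} (snd p) * (ennreal (w (fst p)) *
        indicator {p. (snd p \<le> F (fst p)) \<noteq> (snd p \<le> G (fst p))} p)) =
      (\<lambda>(x, u). indicator {0<..<1} u * (ennreal (w x) * ?A x u))"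
      by (auto split: split_indicator)
    finally show "(\<lambda>(x, u). indicator {0<..<1} u * (ennreal (w x) * ?A x u)) \<in>
      borel_measurable (lborel \<Otimes>\<^sub>M lborel)" .
  qed
  also have "\<dots> = (\<integral>\<^sup>+x. ennreal (w x) * (\<integral>\<^sup>+u. indicator {0<..<1} u * ?A x u \<partial>lborel) \<partial>lborel)"
    by (intro nn_integral_cong, subst nn_integral_cmult[symmetric]) (auto simp: mult_ac)
  finally show ?thesis unfolding outer .
qed

section \<open>Perturbed quantiles and the space of directions\<close>

text \<open>Caratheodory's factorization M z - M x = s z (z - x), with s continuous at x, avoids a
  division by q n - x, which may vanish.\<close>

lemma DERIV_along_sequence:
  fixes M :: "real \<Rightarrow> real"
  assumes M: "(M has_real_derivative D) (at x)" and q: "q \<longlonglongrightarrow> x"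
    and lim: "(\<lambda>n. (q n - x) / t n) \<longlonglongrightarrow> c"
  shows "(\<lambda>n. (M (q n) - M x) / t n) \<longlonglongrightarrow> D * c"
proof -
  from M obtain s where s: "\<And>z. M z - M x = s z * (z - x)" "isCont s x" "s x = D"
    unfolding CARAT_DERIV by blast
  have "(\<lambda>n. s (q n) * ((q n - x) / t n)) \<longlonglongrightarrow> s x * c"
    by (intro tendsto_mult lim isCont_tendsto_compose[OF s(2) q])
  then show ?thesis by (simp add: s)
qed

text \<open>The same factorization read backwards: the slopes s (q n) tend to D and are therefore
  eventually nonzero.\<close>

lemma DERIV_along_sequence_inverse:
  fixes F :: "real \<Rightarrow> real"
  assumes F: "(F has_real_derivative D) (at x)" and D: "D \<noteq> 0" and q: "q \<longlonglongrightarrow> x"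
    and lim: "(\<lambda>n. (F (q n) - F x) / t n) \<longlonglongrightarrow> c"
  shows "(\<lambda>n. (q n - x) / t n) \<longlonglongrightarrow> c / D"
proof -
  from F obtain s where s: "\<And>z. F z - F x = s z * (z - x)" "isCont s x" "s x = D"
    unfolding CARAT_DERIV by blast
  have sq: "(\<lambda>n. s (q n)) \<longlonglongrightarrow> D" using isCont_tendsto_compose[OF s(2) q] s(3) by simp
  have "(\<lambda>n. (F (q n) - F x) / t n / s (q n)) \<longlonglongrightarrow> c / D"
    by (intro tendsto_divide lim sq D)
  moreover have "eventually (\<lambda>n. (F (q n) - F x) / t n / s (q n) = (q n - x) / t n) sequentially"
    using tendsto_imp_eventually_ne[OF sq D] by eventually_elim (simp add: s)
  ultimately show ?thesis by (rule Lim_transform_eventually)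
qed

context distribution_function
begin

text \<open>The derivative gives strict increase near x, and monotonicity of F carries it to all
  y.\<close>

lemma DERIV_pos_strict_increase:
  assumes "(F has_real_derivative D) (at x)" "0 < D"
  shows "x < y \<Longrightarrow> F x < F y" and "y < x \<Longrightarrow> F y < F x"
proof -
  from DERIV_pos_inc_right[OF assms] obtain d where d: "d > 0" "\<And>h. 0 < h \<Longrightarrow> h < d \<Longrightarrow> F x < F (x + h)"
    by blast
  from DERIV_pos_inc_left[OF assms] obtain d' where d': "d' > 0" "\<And>h. 0 < h \<Longrightarrow> h < d' \<Longrightarrow> F (x - h) < F x"
    by blast
  show "F x < F y" if "x < y"
  proof -
    from that d(1) have "0 < min (d/2) (y - x)" "min (d/2) (y - x) < d" by auto
    then have "F x < F (x + min (d/2) (y - x))" by (rule d(2))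
    also have "\<dots> \<le> F y" by (rule monoD[OF F_mono]) simp
    finally show ?thesis .
  qed
  show "F y < F x" if "y < x"
  proof -
    have "F y \<le> F (x - min (d'/2) (x - y))" by (rule monoD[OF F_mono]) simp
    also from that d'(1) have "0 < min (d'/2) (x - y)" "min (d'/2) (x - y) < d'" by auto
    then have "F (x - min (d'/2) (x - y)) < F x" by (rule d'(2))
    finally show ?thesis .
  qed
qed

text \<open>Once the perturbation is smaller than both gaps u - l and F x - u, the perturbed
  function still passes the level u exactly at x.\<close>

lemma quantile_perturbation_at_jump:
  assumes Fn: "\<And>n. distribution_function (Fn n)"
    and close: "\<And>n y. \<bar>Fn n y - F y\<bar> \<le> d n" "d \<longlonglongrightarrow> 0"
    and u: "0 < u" "u < 1" and left: "\<And>y. y < x \<Longrightarrow> F y \<le> l" and "l < u" "u < F x"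
  shows "eventually (\<lambda>n. quantile (Fn n) u = x) sequentially"
proof -
  have "eventually (\<lambda>n. d n < min (u - l) (F x - u)) sequentially"
    using assms by (intro order_tendstoD(2)[OF close(2)]) auto
  then show ?thesis
  proof eventually_elim
    case (elim n)
    interpret Fn: distribution_function "Fn n" by (rule Fn)
    show ?case
    proof (rule Fn.quantile_eqI[OF u])
      show "u \<le> Fn n x" using close(1)[of n x] elim by auto
      show "Fn n y < u" if "y < x" for y using close(1)[of n y] left[OF that] elim by auto
    qed
  qed
qed

text \<open>The perturbed function crosses the level F x at q n, so F (q n) + t n h (q n) equals F x
  up to |t n| e n. Division by t n gives (F (q n) - F x) / t n -> - h x, and the derivative of F at
  x converts this into the claim for q n. The sign of t n is arbitrary throughout.\<close>

lemma quantile_perturbation_derivative: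
  assumes Fn: "\<And>n. distribution_function (\<lambda>y. F y + t n * g n y)"
    and t: "\<And>n. t n \<noteq> 0" "t \<longlonglongrightarrow> 0"
    and g: "\<And>n y. \<bar>g n y - h y\<bar> \<le> e n" "e \<longlonglongrightarrow> 0"
    and h: "continuous_on UNIV h"
    and F_deriv: "(F has_real_derivative D) (at x)" and D: "0 < D"
    and F_cont: "eventually (\<lambda>y. isCont F y) (nhds x)"
    and Fx: "0 < F x" "F x < 1"
  defines "q \<equiv> \<lambda>n. quantile (\<lambda>y. F y + t n * g n y) (F x)"
  shows "q \<longlonglongrightarrow> x" and "(\<lambda>n. (q n - x) / t n) \<longlonglongrightarrow> - h x / D"
proof -
  have h_isCont: "isCont h y" for y using h by (simp add: continuous_on_eq_continuous_at)
  have Fn_lim: "(\<lambda>n. F y + t n * g n y) \<longlonglongrightarrow> F y" for y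
  proof -
    have "(\<lambda>n. g n y - h y) \<longlonglongrightarrow> 0"
      by (rule Lim_null_comparison[OF _ g(2)]) (use g(1) in auto)
    then have "(\<lambda>n. g n y) \<longlonglongrightarrow> h y" by (simp add: LIM_zero_iff)
    then have "(\<lambda>n. F y + t n * g n y) \<longlonglongrightarrow> F y + 0 * h y" by (intro tendsto_intros t)
    then show ?thesis by simp
  qed
  show qx: "q \<longlonglongrightarrow> x"
  proof (rule order_tendstoI)
    fix y assume "y < x"
    then have "F y < F x" by (rule DERIV_pos_strict_increase[OF F_deriv D])
    then have "eventually (\<lambda>n. F y + t n * g n y < F x) sequentially"
      by (rule order_tendstoD(2)[OF Fn_lim])
    then show "eventually (\<lambda>n. y < q n) sequentially"
      unfolding q_def by eventually_elim (use distribution_function.less_quantile_iff[OF Fn] Fx in auto)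
  next
    fix z assume "x < z"
    then obtain y where y: "x < y" "y < z" using dense by blast
    then have "F x < F y" by (intro DERIV_pos_strict_increase[OF F_deriv D])
    then have "eventually (\<lambda>n. F x < F y + t n * g n y) sequentially"
      by (rule order_tendstoD(1)[OF Fn_lim])
    then show "eventually (\<lambda>n. q n < z) sequentially"
    proof eventually_elim
      case (elim n)
      then have "q n \<le> y"
        unfolding q_def using distribution_function.quantile_le_iff[OF Fn] Fx by auto
      then show ?case using y by simp
    qed
  qed
  \<comment> \<open>The perturbed function may jump at q n: it is known only to be at least F x at q
    n and below F x to the left of it. Replacing g n by the continuous h, at the price |t n| e n,
    allows y to tend to q n from the left, as F is continuous there once q n is close to x.\<close>
  have bound: "eventually (\<lambda>n. \<bar>F (q n) - F x + t n * h (q n)\<bar> \<le> \<bar>t n\<bar> * e n) sequentially"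
    using eventually_compose_filterlim[OF F_cont qx]
  proof eventually_elim
    case (elim n)
    interpret Fn: distribution_function "\<lambda>y. F y + t n * g n y" by (rule Fn)
    have tg: "\<bar>t n * g n y - t n * h y\<bar> \<le> \<bar>t n\<bar> * e n" for y
      using mult_left_mono[OF g(1)[of n y], of "\<bar>t n\<bar>"] by (simp add: abs_mult[symmetric] algebra_simps)
    have "F x \<le> F (q n) + t n * g n (q n)"
      unfolding q_def using Fx by (intro Fn.le_F_quantile)
    with tg[of "q n"] have 1: "- (\<bar>t n\<bar> * e n) \<le> F (q n) - F x + t n * h (q n)" by linarith
    have "F (q n) + t n * h (q n) \<le> F x + \<bar>t n\<bar> * e n"
    proof (rule tendsto_upperbound)
      show "((\<lambda>y. F y + t n * h y) \<longlongrightarrow> F (q n) + t n * h (q n)) (at_left (q n))"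
        using elim h_isCont[of "q n"]
        by (intro tendsto_intros) (auto simp: isCont_def intro: filterlim_mono[OF _ order_refl at_le])
      show "eventually (\<lambda>y. F y + t n * h y \<le> F x + \<bar>t n\<bar> * e n) (at_left (q n))"
        unfolding eventually_at_filter
      proof (rule always_eventually, intro allI impI)
        fix y assume "y \<noteq> q n" "y \<in> {..<q n}"
        then have "F y + t n * g n y < F x"
          unfolding q_def using Fn.less_quantile_iff[of "F x" y] Fx by simp
        with tg[of y] show "F y + t n * h y \<le> F x + \<bar>t n\<bar> * e n" by linarith
      qed
    qed simp
    with 1 show ?case by linarith
  qed
  have "(\<lambda>n. (F (q n) - F x) / t n + h (q n)) \<longlonglongrightarrow> 0"
  proof (rule Lim_null_comparison[OF _ g(2)])
    show "eventually (\<lambda>n. norm ((F (q n) - F x) / t n + h (q n)) \<le> e n) sequentially"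
      using bound
    proof eventually_elim
      case (elim n)
      have "(F (q n) - F x) / t n + h (q n) = (F (q n) - F x + t n * h (q n)) / t n"
        using t(1)[of n] by (simp add: field_simps)
      then show ?case using elim t(1)[of n] by (simp add: field_simps)
    qed
  qed
  from tendsto_diff[OF this isCont_tendsto_compose[OF h_isCont qx]]
  have "(\<lambda>n. (F (q n) - F x) / t n) \<longlonglongrightarrow> - h x" by simp
  then show "(\<lambda>n. (q n - x) / t n) \<longlonglongrightarrow> - h x / D"
    by (intro DERIV_along_sequence_inverse[OF F_deriv _ qx]) (use D in auto)
qed

end

section \<open>Elementary facts on the space \<open>Lm\<close> and its norm\<close>

lemma Lm_measurable: "z \<in> Lm m \<Longrightarrow> z \<in> borel_measurable borel"
  by (simp add: Lm_def)

lemma Lm_bounded: "z \<in> Lm m \<Longrightarrow> bounded (range z)"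
  by (simp add: Lm_def)

lemma Lm_integrable: "z \<in> Lm m \<Longrightarrow> integrable (abs_dm m) (tilde z)"
  by (simp add: Lm_def)

lemma Lm_tendsto:
  assumes "z \<in> Lm m"
  shows "(z \<longlongrightarrow> Lim at_bot z) at_bot" "(z \<longlongrightarrow> Lim at_top z) at_top"
proof -
  from assms obtain l r where l: "(z \<longlongrightarrow> l) at_bot" and r: "(z \<longlongrightarrow> r) at_top"
    by (auto simp: Lm_def)
  show "(z \<longlongrightarrow> Lim at_bot z) at_bot"
    using l tendsto_Lim[OF _ l] by simp
  show "(z \<longlongrightarrow> Lim at_top z) at_top"
    using r tendsto_Lim[OF _ r] by simp
qed

lemma Lim_linear:
  assumes "g \<in> Lm m" "h \<in> Lm m"
  shows "Lim at_bot (\<lambda>x. a * g x + b * h x) = a * Lim at_bot g + b * Lim at_bot h"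
    "Lim at_top (\<lambda>x. a * g x + b * h x) = a * Lim at_top g + b * Lim at_top h"
proof -
  note l = Lm_tendsto[OF assms(1)] Lm_tendsto[OF assms(2)]
  show "Lim at_bot (\<lambda>x. a * g x + b * h x) = a * Lim at_bot g + b * Lim at_bot h"
    by (rule tendsto_Lim) (simp, intro tendsto_add tendsto_mult tendsto_const l)
  show "Lim at_top (\<lambda>x. a * g x + b * h x) = a * Lim at_top g + b * Lim at_top h"
    by (rule tendsto_Lim) (simp, intro tendsto_add tendsto_mult tendsto_const l)
qed

lemma tilde_linear:
  assumes "g \<in> Lm m" "h \<in> Lm m"
  shows "tilde (\<lambda>x. a * g x + b * h x) = (\<lambda>x. a * tilde g x + b * tilde h x)"
  unfolding tilde_def Lim_linear[OF assms] by (auto simp: algebra_simps)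

lemma tilde_eq:
  assumes "(z \<longlongrightarrow> 0) at_bot" "(z \<longlongrightarrow> 0) at_top"
  shows "tilde z = z"
  using tendsto_Lim[OF _ assms(1)] tendsto_Lim[OF _ assms(2)] by (simp add: tilde_def fun_eq_iff)

lemma Lm_linear:
  assumes "g \<in> Lm m" "h \<in> Lm m"
  shows "(\<lambda>x. a * g x + b * h x) \<in> Lm m"
  unfolding Lm_def
proof (intro CollectI conjI)
  note [measurable] = Lm_measurable[OF assms(1)] Lm_measurable[OF assms(2)]
  show "(\<lambda>x. a * g x + b * h x) \<in> borel_measurable borel" by measurable
  note l = Lm_tendsto[OF assms(1)] Lm_tendsto[OF assms(2)]
  show "\<exists>l. ((\<lambda>x. a * g x + b * h x) \<longlongrightarrow> l) at_bot"
    by (rule exI, rule tendsto_add[OF tendsto_mult[OF tendsto_const l(1)] tendsto_mult[OF tendsto_const l(3)]])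
  show "\<exists>l. ((\<lambda>x. a * g x + b * h x) \<longlongrightarrow> l) at_top"
    by (rule exI, rule tendsto_add[OF tendsto_mult[OF tendsto_const l(2)] tendsto_mult[OF tendsto_const l(4)]])
  from assms[THEN Lm_bounded] obtain A B where AB: "\<And>x. \<bar>g x\<bar> \<le> A" "\<And>x. \<bar>h x\<bar> \<le> B"
    unfolding bounded_iff by (metis rangeI real_norm_def)
  show "bounded (range (\<lambda>x. a * g x + b * h x))"
    unfolding bounded_iff
  proof (intro exI[of _ "\<bar>a\<bar> * A + \<bar>b\<bar> * B"] ballI, safe)
    fix x
    have "\<bar>a * g x + b * h x\<bar> \<le> \<bar>a\<bar> * \<bar>g x\<bar> + \<bar>b\<bar> * \<bar>h x\<bar>"
      by (metis abs_mult abs_triangle_ineq)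
    also have "\<dots> \<le> \<bar>a\<bar> * A + \<bar>b\<bar> * B"
      by (intro add_mono mult_left_mono AB) auto
    finally show "norm (a * g x + b * h x) \<le> \<bar>a\<bar> * A + \<bar>b\<bar> * B" by simp
  qed
  show "integrable (abs_dm m) (tilde (\<lambda>x. a * g x + b * h x))"
    unfolding tilde_linear[OF assms] using assms[THEN Lm_integrable] by auto
qed

lemma Lm_diff: "g \<in> Lm m \<Longrightarrow> h \<in> Lm m \<Longrightarrow> (\<lambda>x. g x - h x) \<in> Lm m"
  using Lm_linear[of g m h 1 "-1"] by simp

lemma abs_le_Lm_norm:
  assumes "z \<in> Lm m"
  shows "\<bar>z x\<bar> \<le> Lm_norm m z"
proof -
  have "bdd_above (range (\<lambda>x. \<bar>z x\<bar>))"
    using Lm_bounded[OF assms] by (auto simp: bounded_iff bdd_above_def)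
  then have "\<bar>z x\<bar> \<le> (SUP x. \<bar>z x\<bar>)" by (intro cSUP_upper) auto
  then show ?thesis by (simp add: Lm_norm_def)
qed

lemma integral_tilde_le_Lm_norm: "(LINT x|abs_dm m. \<bar>tilde z x\<bar>) \<le> Lm_norm m z"
  by (simp add: Lm_norm_def)

lemma Lim_le_Lm_norm:
  assumes "z \<in> Lm m"
  shows "\<bar>Lim at_bot z\<bar> \<le> Lm_norm m z" "\<bar>Lim at_top z\<bar> \<le> Lm_norm m z"
proof -
  show "\<bar>Lim at_bot z\<bar> \<le> Lm_norm m z"
    by (rule tendsto_upperbound[OF tendsto_rabs[OF Lm_tendsto(1)[OF assms]]])
      (simp_all add: abs_le_Lm_norm[OF assms])
  show "\<bar>Lim at_top z\<bar> \<le> Lm_norm m z"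
    by (rule tendsto_upperbound[OF tendsto_rabs[OF Lm_tendsto(2)[OF assms]]])
      (simp_all add: abs_le_Lm_norm[OF assms])
qed

lemma Lm_phi_imp_Lm: "z \<in> Lm_phi m \<Longrightarrow> z \<in> Lm m"
  by (simp add: Lm_phi_def)

lemma Lm_phi_distribution_function: "z \<in> Lm_phi m \<Longrightarrow> distribution_function z"
  by unfold_locales (auto simp: Lm_phi_def)

lemma distribution_function_step: "distribution_function (indicator {0..} :: real \<Rightarrow> real)"
proof
  show "mono (indicator {0..} :: real \<Rightarrow> real)" by (auto simp: mono_def split: split_indicator)
  show "((indicator {0..} :: real \<Rightarrow> real) \<longlongrightarrow> indicator {0..} x) (at_right x)" for x :: real
  proof (rule tendsto_eventually)
    have "eventually (\<lambda>y. y \<in> {x<..<(if x < 0 then 0 else x + 1)}) (at_right x)"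
      by (rule eventually_at_right_real) auto
    then show "eventually (\<lambda>y. indicator {0..} y = (indicator {0..} x :: real)) (at_right x)"
      by eventually_elim (auto split: split_indicator if_splits)
  qed
  show "((indicator {0..} :: real \<Rightarrow> real) \<longlongrightarrow> 0) at_bot"
    by (rule tendsto_eventually, rule eventually_mono[OF eventually_gt_at_bot[of 0]]) simp
  show "((indicator {0..} :: real \<Rightarrow> real) \<longlongrightarrow> 1) at_top"
    by (rule tendsto_eventually, rule eventually_mono[OF eventually_ge_at_top[of 0]]) simp
qed

section \<open>The map \<open>phi_psi\<close> for a continuously differentiable m\<close>

locale continuously_differentiable =
  fixes m m' :: "real \<Rightarrow> real"
  assumes m_deriv: "\<And>x. (m has_real_derivative m' x) (at x)"
    and m'_cont: "continuous_on UNIV m'"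
begin

lemma m_isCont: "isCont m x"
  by (rule DERIV_isCont[OF m_deriv])

lemma m'_isCont: "isCont m' x"
  using m'_cont by (simp add: continuous_on_eq_continuous_at)

lemma m_measurable [measurable]: "m \<in> borel_measurable borel"
  by (intro borel_measurable_continuous_onI continuous_at_imp_continuous_on ballI m_isCont)

lemma m'_measurable [measurable]: "m' \<in> borel_measurable borel"
  using m'_cont by (rule borel_measurable_continuous_onI)

text \<open>The choice leaves an additive constant open, which cancels in every difference of values
  of \<open>W\<close>.\<close>

definition W :: "real \<Rightarrow> real" where
  "W = (SOME W. \<forall>x. (W has_real_derivative \<bar>m' x\<bar>) (at x))"

lemma W: "(W has_real_derivative \<bar>m' x\<bar>) (at x)"
proof -
  have "continuous_on UNIV (\<lambda>x. \<bar>m' x\<bar>)" by (intro continuous_intros m'_cont)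
  then have "\<exists>W. \<forall>x. (W has_real_derivative \<bar>m' x\<bar>) (at x)"
    using antiderivative_on_real_line by metis
  then show ?thesis unfolding W_def by (rule someI2_ex) blast
qed

lemma m_diff_le_W: "\<bar>m a - m b\<bar> \<le> \<bar>W a - W b\<bar>"
proof (cases "a \<le> b")
  case True
  then have "\<bar>m b - m a\<bar> \<le> W b - W a"
    by (rule abs_diff_le_absolute_antiderivative[OF m_deriv W])
  then show ?thesis by linarith
next
  case False
  then have "\<bar>m a - m b\<bar> \<le> W a - W b"
    by (intro abs_diff_le_absolute_antiderivative[OF m_deriv W]) simp
  then show ?thesis by linarith
qed

lemma W_measurable [measurable]: "W \<in> borel_measurable borel"
  by (intro borel_measurable_continuous_onI continuous_at_imp_continuous_on ballI DERIV_isCont[OF W])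

lemma abs_dm_eq: "abs_dm m = density lborel (\<lambda>x. ennreal \<bar>m' x\<bar>)"
  by (rule abs_dm_eq_density[OF m_deriv W]) simp

lemma integrable_abs_dm_iff:
  assumes "z \<in> borel_measurable borel"
  shows "integrable (abs_dm m) (z :: real \<Rightarrow> real) \<longleftrightarrow> integrable lborel (\<lambda>x. m' x * z x)"
proof -
  have "integrable (abs_dm m) z \<longleftrightarrow> integrable lborel (\<lambda>x. \<bar>m' x\<bar> * z x)"
    unfolding abs_dm_eq using assms by (subst integrable_density) auto
  also have "\<dots> \<longleftrightarrow> integrable lborel (\<lambda>x. m' x * z x)"
  proof -
    have "integrable lborel (\<lambda>x. \<bar>m' x\<bar> * z x) \<longleftrightarrow> integrable lborel (\<lambda>x. \<bar>m' x * z x\<bar>)"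
      using assms integrable_norm_iff[of "\<lambda>x. \<bar>m' x\<bar> * z x" lborel] by (simp add: abs_mult)
    also have "\<dots> \<longleftrightarrow> integrable lborel (\<lambda>x. m' x * z x)"
      using assms integrable_norm_iff[of "\<lambda>x. m' x * z x" lborel] by simp
    finally show ?thesis .
  qed
  finally show ?thesis .
qed

lemma integral_abs_dm:
  assumes "z \<in> borel_measurable borel"
  shows "(LINT x|abs_dm m. \<bar>z x\<bar> :: real) = (LINT x|lborel. \<bar>m' x * z x\<bar>)"
  unfolding abs_dm_eq using assms by (subst integral_density) (auto simp: abs_mult)

lemma tilde_measurable: "z \<in> borel_measurable borel \<Longrightarrow> tilde z \<in> borel_measurable borel"
  unfolding tilde_def
  by (intro borel_measurable_diff borel_measurable_times borel_measurable_const borel_measurable_indicator) auto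

lemma Lm_integrable_lborel: "z \<in> Lm m \<Longrightarrow> integrable lborel (\<lambda>x. m' x * tilde z x)"
  using integrable_abs_dm_iff[OF tilde_measurable] Lm_measurable Lm_integrable by blast

lemma Lm_integral_le: "z \<in> Lm m \<Longrightarrow> (LINT x|lborel. \<bar>m' x * tilde z x\<bar>) \<le> Lm_norm m z"
  using integral_abs_dm[OF tilde_measurable[OF Lm_measurable]] integral_tilde_le_Lm_norm by metis

lemma phi_psi_measurable [measurable]:
  assumes "distribution_function F"
  shows "phi_psi m F \<in> borel_measurable borel"
proof -
  interpret distribution_function F by fact
  have "phi_psi m F = (\<lambda>u. indicator {0<..<1} u * m (quantile F u))"
    by (auto simp: phi_psi_def)
  then show ?thesis by simp
qed

text \<open>Real-valued form of the Fubini identity with weight |m'|: by \<open>int\<close> the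
  common value is finite, which also yields integrability on the quantile side.\<close>

lemma W_quantile_difference:
  assumes F: "distribution_function F" and G: "distribution_function G"
    and int: "integrable lborel (\<lambda>x. m' x * (G x - F x))"
  shows "integrable lborel (\<lambda>u. indicator {0<..<1} u * \<bar>W (quantile G u) - W (quantile F u)\<bar>)"
    and "(LINT u|lborel. indicator {0<..<1} u * \<bar>W (quantile G u) - W (quantile F u)\<bar>) =
      (LINT x|lborel. \<bar>m' x * (G x - F x)\<bar>)"
proof -
  let ?D = "\<lambda>u. indicator {0<..<1} u * \<bar>W (quantile G u) - W (quantile F u)\<bar>"
  note [measurable] = distribution_function.F_measurable[OF F] distribution_function.F_measurable[OF G]
  have eq: "?D = (\<lambda>u. \<bar>indicator {0<..<1} u * W (quantile G u) - indicator {0<..<1} u * W (quantile F u)\<bar>)"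
    by (auto split: split_indicator)
  note [measurable] = distribution_function.comp_quantile_measurable[OF F W_measurable]
    distribution_function.comp_quantile_measurable[OF G W_measurable]
  have [measurable]: "?D \<in> borel_measurable borel" unfolding eq by measurable
  have nn: "(\<integral>\<^sup>+u. ennreal (?D u) \<partial>lborel) = (\<integral>\<^sup>+x. ennreal \<bar>m' x * (G x - F x)\<bar> \<partial>lborel)"
  proof -
    have "(\<integral>\<^sup>+u. ennreal (?D u) \<partial>lborel) =
        (\<integral>\<^sup>+u. indicator {0<..<1} u * ennreal \<bar>W (quantile G u) - W (quantile F u)\<bar> \<partial>lborel)"
      by (intro nn_integral_cong) (auto split: split_indicator)
    also have "\<dots> = (\<integral>\<^sup>+x. ennreal \<bar>m' x\<bar> * ennreal \<bar>G x - F x\<bar> \<partial>lborel)"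
      by (rule nn_integral_quantile_difference[OF F G _ W]) auto
    also have "\<dots> = (\<integral>\<^sup>+x. ennreal \<bar>m' x * (G x - F x)\<bar> \<partial>lborel)"
      by (simp add: abs_mult ennreal_mult)
    finally show ?thesis .
  qed
  have int': "integrable lborel (\<lambda>x. \<bar>m' x * (G x - F x)\<bar>)" using int by (rule integrable_abs)
  then have "(\<integral>\<^sup>+x. ennreal \<bar>m' x * (G x - F x)\<bar> \<partial>lborel) = ennreal (LINT x|lborel. \<bar>m' x * (G x - F x)\<bar>)"
    by (intro nn_integral_eq_integral) auto
  with nn have nn': "(\<integral>\<^sup>+u. ennreal (?D u) \<partial>lborel) = ennreal (LINT x|lborel. \<bar>m' x * (G x - F x)\<bar>)" by simp
  show i: "integrable lborel ?D"
    by (rule integrableI_nonneg) (use nn' in auto)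
  show "(LINT u|lborel. ?D u) = (LINT x|lborel. \<bar>m' x * (G x - F x)\<bar>)"
    using nn' by (subst integral_eq_nn_integral) auto
qed

text \<open>Compared with the step function at \<open>0\<close>, whose quantile function is \<open>0\<close>, the difference
  \<open>F - indicator {0..}\<close> is exactly \<open>tilde F\<close>.\<close>

lemma phi_psi_integrable:
  assumes F: "F \<in> Lm_phi m"
  shows "integrable lborel (phi_psi m F)"
proof -
  let ?H = "indicator {0..} :: real \<Rightarrow> real"
  interpret F: distribution_function F using F by (rule Lm_phi_distribution_function)
  interpret H: distribution_function ?H by (rule distribution_function_step)
  have "tilde F x = F x - ?H x" for x
    using tendsto_Lim[OF _ F.F_bot] tendsto_Lim[OF _ F.F_top] by (simp add: tilde_def)
  then have int: "integrable lborel (\<lambda>x. m' x * (F x - ?H x))"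
    using Lm_integrable_lborel[OF Lm_phi_imp_Lm[OF F]] by simp
  have H: "quantile ?H u = 0" if "0 < u" "u < 1" for u
    by (rule H.quantile_eqI[OF that]) (use that in auto)
  \<comment> \<open>Majorant from |m x| <= |m x - m 0| + |m 0| at x = \<open>quantile F u\<close>,
    with 0 as the quantile of the step function.\<close>
  have *: "integrable lborel (\<lambda>u. indicator {0<..<1} u * \<bar>W (quantile F u) - W (quantile ?H u)\<bar> +
      indicator {0<..<1} u * \<bar>m 0\<bar>)"
    by (intro Bochner_Integration.integrable_add W_quantile_difference(1) int
        F.distribution_function_axioms H.distribution_function_axioms) auto
  show ?thesis
  proof (rule Bochner_Integration.integrable_bound[OF *])
    show "phi_psi m F \<in> borel_measurable lborel"
      using phi_psi_measurable[OF F.distribution_function_axioms] by simp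
    show "AE u in lborel. norm (phi_psi m F u) \<le> norm (indicator {0<..<1} u *
        \<bar>W (quantile F u) - W (quantile ?H u)\<bar> + indicator {0<..<1} u * \<bar>m 0\<bar>)"
    proof (intro always_eventually allI)
      fix u
      show "norm (phi_psi m F u) \<le> norm (indicator {0<..<1} u *
        \<bar>W (quantile F u) - W (quantile ?H u)\<bar> + indicator {0<..<1} u * \<bar>m 0\<bar>)"
        using m_diff_le_W[of "quantile F u" 0] H[of u] by (auto simp: phi_psi_def split: split_indicator)
    qed
  qed
qed

lemma phi_psi_in_BB:
  assumes F: "F \<in> Lm_phi m"
  shows "phi_psi m F \<in> BB"
  unfolding BB_def
proof (intro CollectI conjI ballI)
  interpret F: distribution_function F using F by (rule Lm_phi_distribution_function)
  show "\<forall>u. u \<notin> {0<..<1} \<longrightarrow> phi_psi m F u = 0" by (simp add: phi_psi_def)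
  have "integrable lborel (\<lambda>u. indicator {0<..<1} u *\<^sub>R phi_psi m F u)"
    by (intro integrable_mult_indicator phi_psi_integrable F) simp
  then show "set_integrable lborel {0<..<1} (phi_psi m F)" by (simp add: set_integrable_def)
  fix u :: real assume "u \<in> {0<..<1}"
  then have u: "0 < u" "u < 1" by auto
  show "(phi_psi m F \<longlongrightarrow> phi_psi m F u) (at_left u)"
  proof (rule Lim_transform_eventually)
    show "((\<lambda>v. m (quantile F v)) \<longlongrightarrow> phi_psi m F u) (at_left u)"
      using isCont_tendsto_compose[OF m_isCont F.quantile_tendsto_left[OF u]] u by (simp add: phi_psi_def)
    show "eventually (\<lambda>v. m (quantile F v) = phi_psi m F v) (at_left u)"
      using eventually_at_left_unit[OF u] by eventually_elim (use u in \<open>simp add: phi_psi_def\<close>)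
  qed
  from F.quantile_right_limit[OF u] obtain l where l: "(quantile F \<longlongrightarrow> l) (at_right u)" ..
  have "(phi_psi m F \<longlongrightarrow> m l) (at_right u)"
  proof (rule Lim_transform_eventually)
    show "((\<lambda>v. m (quantile F v)) \<longlongrightarrow> m l) (at_right u)"
      by (rule isCont_tendsto_compose[OF m_isCont l])
    show "eventually (\<lambda>v. m (quantile F v) = phi_psi m F v) (at_right u)"
      using eventually_at_right_unit[OF u] by eventually_elim (use u in \<open>simp add: phi_psi_def\<close>)
  qed
  then show "\<exists>l. (phi_psi m F \<longlongrightarrow> l) (at_right u)" ..
qed

end

section \<open>Distribution functions with a piecewise continuous density\<close>

text \<open>The value k v depends only on \<open>k\<^sub>0\<close> just to the left of v, so a bound
  for \<open>k\<^sub>0\<close> throughout (c, v) passes to k v. Strictness is lost in the limit,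
  which the use of e / 2 absorbs.\<close>

lemma left_limit_regularization:
  fixes k\<^sub>0 :: "real \<Rightarrow> real"
  assumes left: "\<And>u. 0 < u \<Longrightarrow> u < 1 \<Longrightarrow> \<exists>l. (k\<^sub>0 \<longlongrightarrow> l) (at_left u)"
    and right: "\<And>u. 0 < u \<Longrightarrow> u < 1 \<Longrightarrow> \<exists>l. (k\<^sub>0 \<longlongrightarrow> l) (at_right u)"
    and k: "\<And>u. 0 < u \<Longrightarrow> u < 1 \<Longrightarrow> k u = Lim (at_left u) k\<^sub>0"
    and u: "0 < u" "u < 1"
  shows "(k \<longlongrightarrow> k u) (at_left u)" and "\<exists>l. (k \<longlongrightarrow> l) (at_right u)"
proof -
  have k_lim: "(k\<^sub>0 \<longlongrightarrow> k v) (at_left v)" if "0 < v" "v < 1" for v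
    using left[OF that] k[OF that] tendsto_Lim[of "at_left v" k\<^sub>0] by auto
  have close: "dist (k v) l \<le> e"
    if "0 < v" "v < 1" "c < v" and near: "\<And>w. c < w \<Longrightarrow> w < v \<Longrightarrow> dist (k\<^sub>0 w) l < e" for v c l e
  proof (rule tendsto_upperbound[OF tendsto_dist[OF k_lim[OF that(1,2)] tendsto_const]])
    show "eventually (\<lambda>w. dist (k\<^sub>0 w) l \<le> e) (at_left v)"
      using eventually_at_left_real[OF \<open>c < v\<close>] by eventually_elim (use near in \<open>auto intro: less_imp_le\<close>)
  qed simp
  show "(k \<longlongrightarrow> k u) (at_left u)"
  proof (rule tendstoI)
    fix e :: real assume "e > 0"
    then have "eventually (\<lambda>w. dist (k\<^sub>0 w) (k u) < e / 2) (at_left u)"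
      by (intro tendstoD[OF k_lim[OF u]]) simp
    then obtain c where c: "c < u" "\<And>w. c < w \<Longrightarrow> w < u \<Longrightarrow> dist (k\<^sub>0 w) (k u) < e / 2"
      by (auto simp: eventually_at_left_field)
    have "eventually (\<lambda>v. v \<in> {max 0 c<..<u}) (at_left u)"
      using u c(1) by (intro eventually_at_left_real) auto
    then show "eventually (\<lambda>v. dist (k v) (k u) < e) (at_left u)"
    proof eventually_elim
      case (elim v)
      then have "dist (k v) (k u) \<le> e / 2" using u by (intro close[of v c] c(2)) auto
      then show ?case using \<open>e > 0\<close> by simp
    qed
  qed
  obtain l where l: "(k\<^sub>0 \<longlongrightarrow> l) (at_right u)" using right[OF u] by blast
  have "(k \<longlongrightarrow> l) (at_right u)"
  proof (rule tendstoI)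
    fix e :: real assume "e > 0"
    then have "eventually (\<lambda>w. dist (k\<^sub>0 w) l < e / 2) (at_right u)"
      by (intro tendstoD[OF l]) simp
    then obtain c where c: "u < c" "\<And>w. u < w \<Longrightarrow> w < c \<Longrightarrow> dist (k\<^sub>0 w) l < e / 2"
      by (auto simp: eventually_at_right_field)
    have "eventually (\<lambda>v. v \<in> {u<..<min 1 c}) (at_right u)"
      using u c(1) by (intro eventually_at_right_real) auto
    then show "eventually (\<lambda>v. dist (k v) l < e) (at_right u)"
    proof eventually_elim
      case (elim v)
      then have "dist (k v) l \<le> e / 2" using u by (intro close[of v u] c(2)) auto
      then show ?case using \<open>e > 0\<close> by simp
    qed
  qed
  then show "\<exists>l. (k \<longlongrightarrow> l) (at_right u)" ..
qed

text \<open>The limits at the jumps are imposed on 1 / f because, composed with the quantile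
  function, it is the factor of the derivative that must have one-sided limits; f itself may tend to
  infinity there. They are asked for only on sides where I has further points, as quantiles do not
  approach the jump from a side without mass.\<close>

locale piecewise_density = distribution_function F for F +
  fixes I :: "real set" and f :: "real \<Rightarrow> real"
  assumes I: "is_interval I"
    and F_on_I: "AE x in interval_measure F. x \<in> I"
    and jumps: "finite {x. \<not> isCont F x}"
    and density: "\<And>x. x \<in> interior I \<Longrightarrow> isCont F x \<Longrightarrow> (F has_real_derivative f x) (at x)"
    and f_pos: "\<And>x. x \<in> interior I \<Longrightarrow> isCont F x \<Longrightarrow> 0 < f x"
    and f_cont: "continuous_on {x \<in> interior I. isCont F x} f"
    and f_left: "\<And>x. \<not> isCont F x \<Longrightarrow> \<exists>a\<in>I. a < x \<Longrightarrow> \<exists>l. ((\<lambda>y. 1 / f y) \<longlongrightarrow> l) (at_left x)"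
    and f_right: "\<And>x. \<not> isCont F x \<Longrightarrow> \<exists>b\<in>I. x < b \<Longrightarrow> \<exists>l. ((\<lambda>y. 1 / f y) \<longlongrightarrow> l) (at_right x)"
begin

abbreviation Q :: "real \<Rightarrow> real" where
  "Q \<equiv> quantile F"

definition smooth_points :: "real set" where
  "smooth_points = {x \<in> interior I. isCont F x}"

text \<open>\<open>\<kappa>\<close> is the left-continuous version of \<open>\<kappa>\<^sub>0 = (1 / f) \<circ> Q\<close>; they differ at most at the points \<open>F(x-)\<close>
  for the jumps \<open>x\<close>.\<close>

definition \<kappa>\<^sub>0 :: "real \<Rightarrow> real" where
  "\<kappa>\<^sub>0 u = (if 0 < u \<and> u < 1 \<and> isCont F (Q u) then 1 / f (Q u) else 0)"

definition \<kappa> :: "real \<Rightarrow> real" where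
  "\<kappa> u = (if 0 < u \<and> u < 1 then Lim (at_left u) \<kappa>\<^sub>0 else 0)"

section \<open>Location of the mass of F and its smooth points\<close>

lemma F_eq_if_no_support:
  assumes "a \<le> b" "{a<..b} \<inter> I = {}"
  shows "F a = F b"
proof -
  have "AE x in interval_measure F. x \<notin> {a<..b}"
    using F_on_I by eventually_elim (use assms(2) in blast)
  then have "emeasure (interval_measure F) {x \<in> space (interval_measure F). x \<in> {a<..b}} = 0"
    by (rule emeasure_eq_0_AE)
  moreover have "emeasure (interval_measure F) {a<..b} = ennreal (F b - F a)"
    using assms(1) F_mono F_right
    by (intro emeasure_interval_measure_Ioc) (auto simp: mono_def continuous_within)
  moreover have "{x \<in> space (interval_measure F). x \<in> {a<..b}} = {a<..b}" by auto
  ultimately have "F b - F a \<le> 0" by (simp add: ennreal_eq_0_iff)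
  with monoD[OF F_mono assms(1)] show ?thesis by simp
qed

text \<open>Otherwise F would be constant up to y and equal to its limit 0. The asymmetry with
  \<open>support_above\<close>, which has the strict \<open>y < b\<close>, stems from the half-open
  intervals (a, b] of the Stieltjes measure.\<close>

lemma support_below:
  assumes "0 < F y"
  shows "\<exists>a\<in>I. a \<le> y"
proof (rule ccontr)
  assume "\<not> ?thesis"
  then have eq: "F y = F a" if "a \<le> y" for a
    using that by (intro F_eq_if_no_support[symmetric]) auto
  have "eventually (\<lambda>a. F y = F a) at_bot"
    using eventually_le_at_bot[of y] by eventually_elim (rule eq)
  from Lim_transform_eventually[OF tendsto_const this] have "(F \<longlongrightarrow> F y) at_bot" .
  from tendsto_unique[OF trivial_limit_at_bot_linorder this F_bot] have "F y = 0" .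
  with assms show False by simp
qed

lemma support_above:
  assumes "F y < 1"
  shows "\<exists>b\<in>I. y < b"
proof (rule ccontr)
  assume "\<not> ?thesis"
  then have eq: "F y = F b" if "y \<le> b" for b
    using that by (intro F_eq_if_no_support) auto
  have "eventually (\<lambda>b. F y = F b) at_top"
    using eventually_ge_at_top[of y] by eventually_elim (rule eq)
  from Lim_transform_eventually[OF tendsto_const this] have "(F \<longlongrightarrow> F y) at_top" .
  from tendsto_unique[OF trivial_limit_at_top_linorder this F_top] have "F y = 1" .
  with assms show False by simp
qed

lemma interior_I:
  assumes "a \<in> I" "b \<in> I" "a < x" "x < b"
  shows "x \<in> interior I"
proof (rule interiorI[of "{a<..<b}"])
  show "{a<..<b} \<subseteq> I"
    using mem_is_interval_1_I[OF I assms(1,2)] by auto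
qed (use assms in auto)

lemma open_smooth_points: "open smooth_points"
proof -
  have "smooth_points = interior I \<inter> - {x. \<not> isCont F x}" by (auto simp: smooth_points_def)
  then show ?thesis using finite_imp_closed[OF jumps] by auto
qed

lemma eventually_smooth: "x \<in> smooth_points \<Longrightarrow> eventually (\<lambda>y. y \<in> smooth_points) (nhds x)"
  using open_smooth_points by (rule eventually_nhds_in_open)

lemma eventually_isCont_near: "eventually (\<lambda>y. y \<noteq> x \<longrightarrow> isCont F y) (nhds x)"
proof -
  have "open (- ({y. \<not> isCont F y} - {x}))"
    by (rule open_Compl[OF finite_imp_closed[OF finite_Diff[OF jumps]]])
  then have "eventually (\<lambda>y. y \<in> - ({y. \<not> isCont F y} - {x})) (nhds x)"
    by (rule eventually_nhds_in_open) simp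
  then show ?thesis by eventually_elim auto
qed

lemma smooth_deriv: "x \<in> smooth_points \<Longrightarrow> (F has_real_derivative f x) (at x)"
  and smooth_pos: "x \<in> smooth_points \<Longrightarrow> 0 < f x"
  using density f_pos by (auto simp: smooth_points_def)

lemma smooth_f_isCont: "x \<in> smooth_points \<Longrightarrow> isCont f x"
  using f_cont open_smooth_points continuous_on_eq_continuous_at
  unfolding smooth_points_def[symmetric] by blast

lemma isCont_at_left: "isCont F x \<Longrightarrow> (F \<longlongrightarrow> F x) (at_left x)"
  by (auto simp: isCont_def intro: filterlim_mono[OF _ order_refl at_le])

lemma smooth_F_unit:
  assumes "x \<in> smooth_points"
  shows "0 < F x" "F x < 1"
proof -
  note inc = DERIV_pos_strict_increase[OF smooth_deriv[OF assms] smooth_pos[OF assms]]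
  show "0 < F x" using inc(2)[of "x - 1"] F_nonneg[of "x - 1"] by simp
  show "F x < 1" using inc(1)[of "x + 1"] F_le_1[of "x + 1"] by simp
qed

lemma quantile_F_smooth:
  assumes "x \<in> smooth_points"
  shows "Q (F x) = x"
  using smooth_F_unit[OF assms] DERIV_pos_strict_increase(2)[OF smooth_deriv[OF assms] smooth_pos[OF assms]]
  by (intro quantile_eqI) auto

text \<open>To the left of \<open>Q u\<close> the values of F stay below u, and continuity passes
  this to \<open>Q u\<close> itself.\<close>

lemma F_quantile_isCont:
  assumes u: "0 < u" "u < 1" and "isCont F (Q u)"
  shows "F (Q u) = u"
proof (rule antisym)
  show "F (Q u) \<le> u"
  proof (rule tendsto_upperbound[OF isCont_at_left[OF assms(3)]])
    show "eventually (\<lambda>y. F y \<le> u) (at_left (Q u))"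
      unfolding eventually_at_filter
      by (rule always_eventually) (use less_quantile_iff[OF u] in \<open>auto intro: less_imp_le\<close>)
  qed simp
qed (rule le_F_quantile[OF u])

lemma left_approach_isCont:
  assumes u: "0 < u" "u < 1" and "isCont F (Q u)" and "l < u"
  shows "\<exists>y<Q u. l < F y"
proof -
  have "eventually (\<lambda>y. l < F y) (at_left (Q u))"
    using assms F_quantile_isCont[OF u] by (intro order_tendstoD(1)[OF isCont_at_left]) auto
  moreover have "eventually (\<lambda>y. y < Q u) (at_left (Q u))"
    by (simp add: eventually_at_filter)
  ultimately have "eventually (\<lambda>y. l < F y \<and> y < Q u) (at_left (Q u))"
    by (rule eventually_conj)
  then show ?thesis using eventually_happens[of _ "at_left (Q u)"] by force
qed

text \<open>By continuity F is already positive strictly to the left of \<open>Q u\<close>, and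
  \<open>F (Q u) = u < 1\<close>. So I has points strictly on both sides of
  \<open>Q u\<close>.\<close>

lemma quantile_smooth:
  assumes u: "0 < u" "u < 1" and "isCont F (Q u)"
  shows "Q u \<in> smooth_points"
proof -
  obtain y where "y < Q u" "0 < F y" using left_approach_isCont[OF assms u(1)] by blast
  with support_below obtain a where "a \<in> I" "a < Q u" by force
  moreover obtain b where "b \<in> I" "Q u < b"
    using support_above[of "Q u"] F_quantile_isCont[OF assms] u by auto
  ultimately show ?thesis using interior_I assms by (auto simp: smooth_points_def)
qed

text \<open>F and \<open>Q\<close> are mutually inverse between the smooth points and these levels,
  which form the range of the substitution u = F(x).\<close>

lemma F_image_smooth: "F ` smooth_points = {u. 0 < u \<and> u < 1 \<and> isCont F (Q u)}"
proof (intro equalityI subsetI)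
  fix u assume "u \<in> F ` smooth_points"
  then show "u \<in> {u. 0 < u \<and> u < 1 \<and> isCont F (Q u)}"
    using smooth_F_unit quantile_F_smooth by (auto simp: smooth_points_def)
next
  fix u assume "u \<in> {u. 0 < u \<and> u < 1 \<and> isCont F (Q u)}"
  then show "u \<in> F ` smooth_points"
    using quantile_smooth F_quantile_isCont by (metis (mono_tags, lifting) image_eqI mem_Collect_eq)
qed

section \<open>One-sided limits of 1 / f along the quantile function\<close>

lemma \<kappa>\<^sub>0_nonneg: "0 \<le> \<kappa>\<^sub>0 u"
  using smooth_pos[OF quantile_smooth] by (auto simp: \<kappa>\<^sub>0_def less_imp_le)

text \<open>A smooth point lies between \<open>Q u\<close> and y: I reaches beyond
  \<open>Q u\<close> because \<open>F (Q u) < 1\<close>, and finitely many jumps cannot fill an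
  interval. F increases strictly at that point.\<close>

lemma quantile_right_cont:
  assumes u: "0 < u" "u < 1" and Fu: "F (Q u) = u"
  shows "(Q \<longlongrightarrow> Q u) (at_right u)"
proof (rule quantile_tendsto_right[OF u])
  fix y assume y: "Q u < y"
  obtain a where a: "a \<in> I" "a \<le> Q u" using support_below[of "Q u"] Fu u by auto
  obtain b where b: "b \<in> I" "Q u < b" using support_above[of "Q u"] Fu u by auto
  have "infinite {Q u<..<min b y}" using y b by simp
  then obtain z where z: "z \<in> {Q u<..<min b y} - {x. \<not> isCont F x}"
    using infinite_imp_nonempty[OF Diff_infinite_finite[OF jumps]] by blast
  then have "z \<in> smooth_points"
    using a b by (auto simp: smooth_points_def intro: interior_I)
  then have "F z < F y"
    using z by (intro DERIV_pos_strict_increase(1)[OF smooth_deriv smooth_pos]) auto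
  moreover have "F (Q u) \<le> F z" using z by (intro monoD[OF F_mono]) auto
  ultimately show "u < F y" using Fu by simp
qed

lemma \<kappa>\<^sub>0_tendsto_isCont:
  assumes u: "0 < u" "u < 1" and cont: "isCont F (Q u)"
    and lim: "(Q \<longlongrightarrow> Q u) A" and unit: "eventually (\<lambda>v. 0 < v \<and> v < 1) A"
  shows "(\<kappa>\<^sub>0 \<longlongrightarrow> \<kappa>\<^sub>0 u) A"
proof (rule Lim_transform_eventually)
  have sm: "Q u \<in> smooth_points" using quantile_smooth[OF u cont] .
  have "((\<lambda>v. 1 / f (Q v)) \<longlongrightarrow> 1 / f (Q u)) A"
    using smooth_pos[OF sm]
    by (intro tendsto_divide tendsto_const isCont_tendsto_compose[OF smooth_f_isCont[OF sm] lim]) simp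
  then show "((\<lambda>v. 1 / f (Q v)) \<longlongrightarrow> \<kappa>\<^sub>0 u) A" using u cont by (simp add: \<kappa>\<^sub>0_def)
  show "eventually (\<lambda>v. 1 / f (Q v) = \<kappa>\<^sub>0 v) A"
    using eventually_compose_filterlim[OF eventually_smooth[OF sm] lim] unit
    by eventually_elim (auto simp: \<kappa>\<^sub>0_def smooth_points_def)
qed

text \<open>\<open>Q\<close> approaches x without reaching it, and finiteness of the jumps leaves
  only continuity points of F near x other than x itself. There \<open>\<kappa>\<^sub>0\<close> is 1
  / f composed with \<open>Q\<close>.\<close>

lemma \<kappa>\<^sub>0_tendsto_jump:
  assumes lim: "filterlim Q (at x within S) A" and f: "((\<lambda>y. 1 / f y) \<longlongrightarrow> l) (at x within S)"
    and unit: "eventually (\<lambda>v. 0 < v \<and> v < 1) A"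
  shows "(\<kappa>\<^sub>0 \<longlongrightarrow> l) A"
proof (rule Lim_transform_eventually)
  show "((\<lambda>v. 1 / f (Q v)) \<longlongrightarrow> l) A" using filterlim_compose[OF f lim] .
  have "eventually (\<lambda>y. isCont F y) (at x within S)"
    using eventually_isCont_near[of x] unfolding eventually_at_filter by eventually_elim auto
  from eventually_compose_filterlim[OF this lim] unit
  show "eventually (\<lambda>v. 1 / f (Q v) = \<kappa>\<^sub>0 v) A"
    by eventually_elim (auto simp: \<kappa>\<^sub>0_def)
qed

lemma \<kappa>\<^sub>0_left_isCont:
  "0 < u \<Longrightarrow> u < 1 \<Longrightarrow> isCont F (Q u) \<Longrightarrow> (\<kappa>\<^sub>0 \<longlongrightarrow> \<kappa>\<^sub>0 u) (at_left u)"
  by (rule \<kappa>\<^sub>0_tendsto_isCont) (auto intro: quantile_tendsto_left unit_at_left)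

text \<open>For a level strictly above F(x-) at a jump x, \<open>Q\<close> equals x just to the left
  of u, so \<open>\<kappa>\<^sub>0\<close> is 0 there.\<close>

lemma \<kappa>\<^sub>0_left_flat:
  assumes u: "0 < u" "u < 1" and jump: "\<not> isCont F (Q u)"
    and l: "l < u" "\<And>y. y < Q u \<Longrightarrow> F y \<le> l"
  shows "(\<kappa>\<^sub>0 \<longlongrightarrow> \<kappa>\<^sub>0 u) (at_left u)"
proof (rule tendsto_eventually)
  have "eventually (\<lambda>v. v \<in> {max l 0<..<u}) (at_left u)"
    using u l by (intro eventually_at_left_real) auto
  then show "eventually (\<lambda>v. \<kappa>\<^sub>0 v = \<kappa>\<^sub>0 u) (at_left u)"
  proof eventually_elim
    case (elim v)
    have "Q v = Q u"
    proof (rule quantile_eqI)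
      show "v \<le> F (Q u)" using le_F_quantile[OF u] elim by simp
      show "F y < v" if "y < Q u" for y using l(2)[OF that] elim by simp
    qed (use elim u in auto)
    then show ?case using jump by (simp add: \<kappa>\<^sub>0_def)
  qed
qed

text \<open>At a jump x = \<open>Q u\<close> there are two cases: u > F(x-), where \<open>Q\<close>
  is locally constant on the left, and u = F(x-), where \<open>Q\<close> tends to x strictly from
  below. In the second case F is positive somewhere to the left of x, which provides the point of I
  required by \<open>f_left\<close>.\<close>

lemma \<kappa>\<^sub>0_left_limit:
  assumes u: "0 < u" "u < 1"
  shows "\<exists>l. (\<kappa>\<^sub>0 \<longlongrightarrow> l) (at_left u)"
proof (cases "isCont F (Q u)")
  case True
  then show ?thesis using \<kappa>\<^sub>0_left_isCont[OF u] by blast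
next
  case jump: False
  show ?thesis
  proof (cases "\<exists>l<u. \<forall>y<Q u. F y \<le> l")
    case True
    then show ?thesis using \<kappa>\<^sub>0_left_flat[OF u jump] by blast
  next
    case False
    then have appr: "\<exists>y<Q u. l < F y" if "l < u" for l using that by (meson not_le)
    obtain y where y: "y < Q u" "0 < F y" using appr[OF u(1)] by blast
    from support_below[OF y(2)] y(1) have "\<exists>a\<in>I. a < Q u" by (meson le_less_trans)
    then obtain l where l: "((\<lambda>y. 1 / f y) \<longlongrightarrow> l) (at_left (Q u))" using f_left[OF jump] by blast
    have "filterlim Q (at_left (Q u)) (at_left u)"
      unfolding filterlim_at
    proof
      show "eventually (\<lambda>v. Q v \<in> {..<Q u} \<and> Q v \<noteq> Q u) (at_left u)"
        using eventually_at_left_unit[OF u]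
      proof eventually_elim
        case (elim v)
        then obtain y where "y < Q u" "v < F y" using appr by blast
        then have "Q v < Q u" using quantile_le_iff[of v y] elim u by force
        then show ?case by simp
      qed
    qed (rule quantile_tendsto_left[OF u])
    from \<kappa>\<^sub>0_tendsto_jump[OF this l unit_at_left[OF u]] show ?thesis ..
  qed
qed

text \<open>At a jump x = \<open>Q u\<close>, either u = F(x), so that \<open>Q\<close> exceeds x
  immediately and \<open>f_right\<close> applies, or u < F(x), so that \<open>Q\<close> stays at x
  for a while.\<close>

lemma \<kappa>\<^sub>0_right_limit:
  assumes u: "0 < u" "u < 1"
  shows "\<exists>l. (\<kappa>\<^sub>0 \<longlongrightarrow> l) (at_right u)"
proof (cases "isCont F (Q u)")
  case True
  then have "(\<kappa>\<^sub>0 \<longlongrightarrow> \<kappa>\<^sub>0 u) (at_right u)"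
    using u by (intro \<kappa>\<^sub>0_tendsto_isCont quantile_right_cont F_quantile_isCont unit_at_right)
  then show ?thesis ..
next
  case jump: False
  show ?thesis
  proof (cases "F (Q u) = u")
    case True
    then obtain l where l: "((\<lambda>y. 1 / f y) \<longlongrightarrow> l) (at_right (Q u))"
      using f_right[OF jump] support_above[of "Q u"] u by auto
    have "filterlim Q (at_right (Q u)) (at_right u)"
      unfolding filterlim_at
    proof
      show "eventually (\<lambda>v. Q v \<in> {Q u<..} \<and> Q v \<noteq> Q u) (at_right u)"
        using eventually_at_right_unit[OF u]
      proof eventually_elim
        case (elim v)
        then show ?case using less_quantile_iff[of v "Q u"] True u by auto
      qed
    qed (rule quantile_right_cont[OF u True])
    from \<kappa>\<^sub>0_tendsto_jump[OF this l unit_at_right[OF u]] show ?thesis ..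
  next
    case False
    then have "u < F (Q u)" using le_F_quantile[OF u] by simp
    then have "eventually (\<lambda>v. v \<in> {u<..<min (F (Q u)) 1}) (at_right u)"
      using u by (intro eventually_at_right_real) auto
    then have "eventually (\<lambda>v. \<kappa>\<^sub>0 v = 0) (at_right u)"
    proof eventually_elim
      case (elim v)
      have "Q v = Q u"
        using quantile_le_iff[of v "Q u"] quantile_mono[of u v] elim u by (intro antisym) auto
      then show ?case using jump by (simp add: \<kappa>\<^sub>0_def)
    qed
    then show ?thesis by (blast intro: tendsto_eventually)
  qed
qed

lemma \<kappa>_left_cont: "0 < u \<Longrightarrow> u < 1 \<Longrightarrow> (\<kappa> \<longlongrightarrow> \<kappa> u) (at_left u)"
  and \<kappa>_right_limit: "0 < u \<Longrightarrow> u < 1 \<Longrightarrow> \<exists>l. (\<kappa> \<longlongrightarrow> l) (at_right u)"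
  using left_limit_regularization[OF \<kappa>\<^sub>0_left_limit \<kappa>\<^sub>0_right_limit, of \<kappa> u] by (auto simp: \<kappa>_def)

text \<open>The levels \<open>F(x-)\<close> and \<open>F(x)\<close> of the jumps \<open>x\<close> of \<open>F\<close>.\<close>

definition jump_bounds :: "real set" where
  "jump_bounds = {u. 0 < u \<and> u < 1 \<and> \<not> isCont F (Q u) \<and>
     ((\<forall>l<u. \<exists>y<Q u. l < F y) \<or> F (Q u) = u)}"

text \<open>\<open>Q\<close> is injective on the levels of the first kind, as each jump has a single
  left limit F(x-); levels of the second kind are values of F at jumps.\<close>

lemma finite_jump_bounds: "finite jump_bounds"
proof -
  let ?J = "{x. \<not> isCont F x}"
  let ?A = "{u. 0 < u \<and> u < 1 \<and> \<not> isCont F (Q u) \<and> (\<forall>l<u. \<exists>y<Q u. l < F y)}"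
  have less: "Q u < Q v" if "u \<in> ?A" "v \<in> ?A" "u < v" for u v
  proof -
    from that obtain y where "y < Q v" "u < F y" by blast
    then show ?thesis using quantile_le_iff[of u y] that by force
  qed
  have "inj_on Q ?A"
  proof (rule inj_onI)
    fix u v assume "u \<in> ?A" "v \<in> ?A" "Q u = Q v"
    then show "u = v" using less[of u v] less[of v u] by (cases u v rule: linorder_cases) auto
  qed
  moreover have "Q ` ?A \<subseteq> ?J" by auto
  ultimately have "finite ?A" using jumps by (meson finite_subset finite_imageD)
  moreover have "jump_bounds \<subseteq> ?A \<union> F ` ?J"
  proof
    fix u assume "u \<in> jump_bounds"
    then consider "u \<in> ?A" | "\<not> isCont F (Q u)" "u = F (Q u)" by (auto simp: jump_bounds_def)
    then show "u \<in> ?A \<union> F ` ?J" by cases (blast, blast)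
  qed
  ultimately show ?thesis using jumps by (meson finite_UnI finite_imageI finite_subset)
qed

text \<open>Off these levels \<open>\<kappa>\<^sub>0\<close> is already left-continuous: either F is
  continuous at \<open>Q u\<close>, or \<open>Q\<close> is constant just to the left of u.\<close>

lemma \<kappa>_eq_\<kappa>\<^sub>0:
  assumes "u \<notin> jump_bounds"
  shows "\<kappa> u = \<kappa>\<^sub>0 u"
proof (cases "0 < u \<and> u < 1")
  case True
  then have u: "0 < u" "u < 1" by auto
  have "(\<kappa>\<^sub>0 \<longlongrightarrow> \<kappa>\<^sub>0 u) (at_left u)"
  proof (cases "isCont F (Q u)")
    case True
    then show ?thesis by (rule \<kappa>\<^sub>0_left_isCont[OF u])
  next
    case False
    with assms u have "\<exists>l<u. \<forall>y<Q u. F y \<le> l"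
      by (auto simp: jump_bounds_def not_less) (meson not_le)
    then obtain l where "l < u" "\<And>y. y < Q u \<Longrightarrow> F y \<le> l" by blast
    then show ?thesis by (rule \<kappa>\<^sub>0_left_flat[OF u False])
  qed
  then show ?thesis using u tendsto_Lim[of "at_left u" \<kappa>\<^sub>0] by (simp add: \<kappa>_def)
qed (auto simp: \<kappa>_def \<kappa>\<^sub>0_def)

lemma AE_not_jump_bounds: "AE u in lborel. u \<notin> jump_bounds"
  by (rule AE_I'[of jump_bounds]) (auto intro: finite_imp_null_set_lborel finite_jump_bounds)

lemma AE_\<kappa>_eq_\<kappa>\<^sub>0: "AE u in lborel. \<kappa> u = \<kappa>\<^sub>0 u"
  using AE_not_jump_bounds by eventually_elim (rule \<kappa>_eq_\<kappa>\<^sub>0)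

section \<open>Measurability and the substitution u = F(x)\<close>

lemma \<kappa>\<^sub>0_comp_quantile_measurable:
  assumes [measurable]: "y \<in> borel_measurable borel"
  shows "(\<lambda>u. \<kappa>\<^sub>0 u * y (Q u)) \<in> borel_measurable borel"
proof -
  have "(\<lambda>x. indicator smooth_points x *\<^sub>R (1 / f x)) \<in> borel_measurable borel"
    using f_cont smooth_pos unfolding smooth_points_def[symmetric]
    by (intro borel_measurable_continuous_on_indicator continuous_on_divide continuous_on_const)
      (auto simp: open_smooth_points less_imp_neq[THEN not_sym])
  then have [measurable]: "(\<lambda>x. indicator smooth_points x * (1 / f x)) \<in> borel_measurable borel" by simp
  have "(\<lambda>u. indicator {0<..<1} u * ((indicator smooth_points (Q u) * (1 / f (Q u))) * y (Q u)))
      \<in> borel_measurable borel"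
    by (rule comp_quantile_measurable) measurable
  also have "(\<lambda>u. indicator {0<..<1} u * ((indicator smooth_points (Q u) * (1 / f (Q u))) * y (Q u))) =
      (\<lambda>u. \<kappa>\<^sub>0 u * y (Q u))"
    using quantile_smooth by (auto simp: \<kappa>\<^sub>0_def smooth_points_def split: split_indicator)
  finally show ?thesis .
qed

lemma \<kappa>_comp_quantile_measurable:
  assumes "y \<in> borel_measurable borel"
  shows "(\<lambda>u. \<kappa> u * y (Q u)) \<in> borel_measurable borel"
  by (rule measurable_discrete_difference[OF \<kappa>\<^sub>0_comp_quantile_measurable[OF assms] countable_finite[OF finite_jump_bounds]])
    (auto simp: \<kappa>_eq_\<kappa>\<^sub>0)

text \<open>Under u = F(x) on the smooth points, \<open>\<kappa>\<^sub>0 (F x)\<close> is 1 / f x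
  and cancels the Jacobian f x, leaving y x. Levels belonging to jumps contribute nothing, since
  \<open>\<kappa>\<^sub>0\<close> is 0 there.\<close>

lemma quantile_change_of_variables:
  assumes [measurable]: "y \<in> borel_measurable borel"
  shows "integrable lborel (\<lambda>u. \<kappa>\<^sub>0 u * y (Q u)) \<longleftrightarrow> integrable lborel (\<lambda>x. indicator smooth_points x * y x)"
    and "integrable lborel (\<lambda>u. \<kappa>\<^sub>0 u * y (Q u)) \<Longrightarrow>
      (LINT u|lborel. \<kappa>\<^sub>0 u * y (Q u)) = (LINT x|lborel. indicator smooth_points x * y x)"
proof -
  let ?S = smooth_points and ?H = "\<lambda>u. \<kappa>\<^sub>0 u * y (Q u)"
  have [measurable]: "?S \<in> sets borel" using open_smooth_points by auto
  have inj: "inj_on F ?S" by (rule inj_on_inverseI[of _ Q]) (rule quantile_F_smooth)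
  have cov: "(\<lambda>x. \<bar>f x\<bar> * ?H (F x)) absolutely_integrable_on ?S \<and>
      integral ?S (\<lambda>x. \<bar>f x\<bar> * ?H (F x)) = b \<longleftrightarrow>
      ?H absolutely_integrable_on (F ` ?S) \<and> integral (F ` ?S) ?H = b" for b
    using smooth_deriv
    by (intro has_absolute_integral_change_of_variables_1' inj) (auto intro: has_field_derivative_at_within)
  have H: "\<bar>f x\<bar> * ?H (F x) = y x" if "x \<in> ?S" for x
    using that smooth_pos[OF that] smooth_F_unit[OF that] quantile_F_smooth[OF that]
    by (simp add: \<kappa>\<^sub>0_def smooth_points_def)
  have L: "(\<lambda>x. indicator ?S x *\<^sub>R (\<bar>f x\<bar> * ?H (F x))) = (\<lambda>x. indicator ?S x * y x)"
    using H by (auto split: split_indicator)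
  have R: "(\<lambda>u. indicator (F ` ?S) u *\<^sub>R ?H u) = ?H"
    unfolding F_image_smooth by (auto simp: \<kappa>\<^sub>0_def split: split_indicator)
  have [measurable]: "?H \<in> borel_measurable borel" by (rule \<kappa>\<^sub>0_comp_quantile_measurable) fact
  \<comment> \<open>The substitution rule concerns the completed Lebesgue measure; as the integrands
    are Borel, their integrals agree with those over \<open>lborel\<close>.\<close>
  have iL: "(\<lambda>x. \<bar>f x\<bar> * ?H (F x)) absolutely_integrable_on ?S \<longleftrightarrow> integrable lborel (\<lambda>x. indicator ?S x * y x)"
    unfolding set_integrable_def L by (rule integrable_completion) simp
  have iR: "?H absolutely_integrable_on (F ` ?S) \<longleftrightarrow> integrable lborel ?H"
    unfolding set_integrable_def R by (rule integrable_completion) simp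
  show iff: "integrable lborel ?H \<longleftrightarrow> integrable lborel (\<lambda>x. indicator ?S x * y x)"
    using cov iL iR by blast
  assume *: "integrable lborel ?H"
  have "integral (F ` ?S) ?H = (LINT u|lborel. ?H u)"
    using set_lebesgue_integral_eq_integral(2)[OF iR[THEN iffD2, OF *]]
    unfolding set_lebesgue_integral_def R by (subst (asm) integral_completion) auto
  moreover have "integral ?S (\<lambda>x. \<bar>f x\<bar> * ?H (F x)) = (LINT x|lborel. indicator ?S x * y x)"
    using set_lebesgue_integral_eq_integral(2)[OF iL[THEN iffD2, OF iff[THEN iffD1, OF *]]]
    unfolding set_lebesgue_integral_def L by (subst (asm) integral_completion) auto
  ultimately show "(LINT u|lborel. ?H u) = (LINT x|lborel. indicator ?S x * y x)"
    using cov[of "integral ?S (\<lambda>x. \<bar>f x\<bar> * ?H (F x))"] iL * iff by auto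
qed

lemma AE_I_imp_smooth: "AE x in lborel. x \<in> I \<longrightarrow> x \<in> smooth_points"
proof (rule AE_I')
  show "(I - interior I) \<union> {x. \<not> isCont F x} \<in> null_sets lborel"
  proof (rule null_sets.Un)
    \<comment> \<open>A point of I outside its interior is the least or the greatest element of I.
      If I is unbounded on a side, the corresponding \<open>Inf I\<close> or \<open>Sup I\<close> is
      an arbitrary number, which does no harm in a superset.\<close>
    have "I - interior I \<subseteq> {Inf I, Sup I}"
    proof
      fix x assume x: "x \<in> I - interior I"
      then consider "\<forall>a\<in>I. x \<le> a" | "\<forall>b\<in>I. b \<le> x" using interior_I[of _ _ x] by fastforce
      then show "x \<in> {Inf I, Sup I}"
        using x cInf_eq_minimum[of x I] cSup_eq_maximum[of x I] by cases auto
    qed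
    then have "finite (I - interior I)" by (rule finite_subset) simp
    then show "I - interior I \<in> null_sets lborel" by (rule finite_imp_null_set_lborel)
    show "{x. \<not> isCont F x} \<in> null_sets lborel" by (rule finite_imp_null_set_lborel[OF jumps])
  qed
qed (auto simp: smooth_points_def)

end

section \<open>The derivative\<close>

lemma BB_norm_eq:
  assumes "\<And>u. u \<notin> {0<..<1} \<Longrightarrow> z u = 0"
  shows "BB_norm z = (LINT u|lborel. \<bar>z u\<bar>)"
  unfolding BB_norm_def set_lebesgue_integral_def
  by (rule Bochner_Integration.integral_cong) (use assms in \<open>auto split: split_indicator\<close>)

lemma set_integrable_unit_iff:
  fixes z :: "real \<Rightarrow> real"
  assumes "\<And>u. u \<notin> {0<..<1} \<Longrightarrow> z u = 0"
  shows "set_integrable lborel {0<..<1} z \<longleftrightarrow> integrable lborel z"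
  unfolding set_integrable_def
  by (rule Bochner_Integration.integrable_cong) (use assms in \<open>auto split: split_indicator\<close>)

lemma uniform_limit_zero_limits:
  fixes g :: "nat \<Rightarrow> real \<Rightarrow> real"
  assumes g: "\<And>n. (g n \<longlongrightarrow> 0) A" and close: "\<And>n x. \<bar>g n x - h x\<bar> \<le> e n" "e \<longlonglongrightarrow> 0"
  shows "(h \<longlongrightarrow> 0) A"
proof (rule tendstoI)
  fix r :: real assume "r > 0"
  then have "eventually (\<lambda>n. e n < r / 2) sequentially"
    by (intro order_tendstoD(2)[OF close(2)]) simp
  then obtain n where n: "e n < r / 2" by (auto dest: eventually_happens)
  have "eventually (\<lambda>x. dist (g n x) 0 < r / 2) A"
    using \<open>r > 0\<close> by (intro tendstoD[OF g]) simp
  then show "eventually (\<lambda>x. dist (h x) 0 < r) A"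
  proof eventually_elim
    case (elim x)
    then show ?case using n close(1)[of n x] by (simp add: dist_real_def)
  qed
qed

text \<open>A continuous stand-in for the indicator of the half-line, differing from it only within
  [0, 1]. Continuity is essential because \<open>hat z\<close> has to stay continuous.\<close>

definition ramp :: "real \<Rightarrow> real" where
  "ramp x = max 0 (min 1 x)"

lemma continuous_ramp: "continuous_on UNIV ramp"
  unfolding ramp_def by (intro continuous_intros)

lemma ramp_measurable [measurable]: "ramp \<in> borel_measurable borel"
  by (rule borel_measurable_continuous_onI[OF continuous_ramp])

locale quantile_derivative = continuously_differentiable m m' + piecewise_density F I f
  for m m' F I f +
  assumes F_Lm_phi: "F \<in> Lm_phi m"
begin

text \<open>A nonzero limit of \<open>z\<close> at \<open>\<plusminus>\<infinity>\<close> is kept only if \<open>m\<close> has finite variation there; otherwise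
  it is subtracted, which makes \<open>m' * hat z\<close> integrable for all \<open>z\<close> while keeping \<open>hat z\<close>
  continuous and linear in \<open>z\<close>.\<close>

definition c_top :: real where
  "c_top = (if integrable lborel (\<lambda>x. indicator {0..} x * m' x) then 0 else 1)"

definition c_bot :: real where
  "c_bot = (if integrable lborel (\<lambda>x. indicator {..<0} x * m' x) then 0 else 1)"

definition hat :: "(real \<Rightarrow> real) \<Rightarrow> real \<Rightarrow> real" where
  "hat z x = z x - c_top * Lim at_top z * ramp x - c_bot * Lim at_bot z * ramp (- x)"

text \<open>\<kappa> in place of \<open>\<kappa>\<^sub>0\<close> makes the function left-continuous
  for continuous z, and \<open>hat z\<close> in place of z makes it integrable.\<close>

definition D :: "(real \<Rightarrow> real) \<Rightarrow> real \<Rightarrow> real" where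
  "D z u = - (\<kappa> u * (m' (Q u) * hat z (Q u)))"

text \<open>The coefficient of the limit at plus infinity in \<open>hat z - tilde z\<close>. In
  either case of \<open>c_top\<close> its product with m' is integrable: m' is integrable on the
  half-line, or \<open>p_top\<close> has compact support.\<close>

definition p_top :: "real \<Rightarrow> real" where
  "p_top x = indicator {0..} x - c_top * ramp x"

definition p_bot :: "real \<Rightarrow> real" where
  "p_bot x = indicator {..<0} x - c_bot * ramp (- x)"

lemma hat_eq: "hat z x = tilde z x + Lim at_top z * p_top x + Lim at_bot z * p_bot x"
  by (simp add: hat_def tilde_def p_top_def p_bot_def algebra_simps)

section \<open>Integrability of m' times the corrected direction\<close>

lemma integrable_m'_compact: "integrable lborel (\<lambda>x. indicator {a..b} x * m' x)"
  using borel_integrable_compact[of "{a..b}" m'] continuous_on_subset[OF m'_cont]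
  by (simp add: indicator_scaleR_eq_if mult.commute if_distrib cong: if_cong)

lemma integrable_m'_supported:
  fixes p :: "real \<Rightarrow> real"
  assumes [measurable]: "p \<in> borel_measurable borel" and p: "\<And>x. \<bar>p x\<bar> \<le> indicator {a..b} x"
  shows "integrable lborel (\<lambda>x. m' x * p x)"
proof (rule Bochner_Integration.integrable_bound[OF integrable_m'_compact[of a b]])
  show "AE x in lborel. norm (m' x * p x) \<le> norm (indicator {a..b} x * m' x)"
  proof (intro always_eventually allI)
    fix x
    show "norm (m' x * p x) \<le> norm (indicator {a..b} x * m' x)"
      using mult_left_mono[OF p[of x], of "\<bar>m' x\<bar>"] by (simp add: abs_mult mult.commute)
  qed
qed simp

lemma p_top_integrable: "integrable lborel (\<lambda>x. m' x * p_top x)"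
proof (cases "integrable lborel (\<lambda>x. indicator {0..} x * m' x)")
  case True
  then show ?thesis by (simp add: p_top_def c_top_def mult.commute)
next
  case False
  then have "p_top = (\<lambda>x. indicator {0..} x - ramp x)" by (simp add: p_top_def c_top_def fun_eq_iff)
  then show ?thesis
    by (intro integrable_m'_supported[of _ 0 1]) (auto simp: ramp_def split: split_indicator)
qed

lemma p_bot_integrable: "integrable lborel (\<lambda>x. m' x * p_bot x)"
proof (cases "integrable lborel (\<lambda>x. indicator {..<0} x * m' x)")
  case True
  then show ?thesis by (simp add: p_bot_def c_bot_def mult.commute)
next
  case False
  then have "p_bot = (\<lambda>x. indicator {..<0} x - ramp (- x))" by (simp add: p_bot_def c_bot_def fun_eq_iff)
  then show ?thesis
    by (intro integrable_m'_supported[of _ "-1" 0]) (auto simp: ramp_def split: split_indicator)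
qed

text \<open>Operator bound of \<open>D\<close>: the 1 accounts for \<open>tilde z\<close>, and the
  two integrals for the limits of z, which are bounded by its norm.\<close>

definition C :: real where
  "C = 1 + (LINT x|lborel. \<bar>m' x * p_top x\<bar>) + (LINT x|lborel. \<bar>m' x * p_bot x\<bar>)"

lemma hat_integrable:
  assumes z: "z \<in> Lm m"
  shows "integrable lborel (\<lambda>x. m' x * hat z x)"
    and "(LINT x|lborel. \<bar>m' x * hat z x\<bar>) \<le> C * Lm_norm m z"
proof -
  let ?r = "Lim at_top z" and ?l = "Lim at_bot z"
  have eq: "(\<lambda>x. m' x * hat z x) = (\<lambda>x. m' x * tilde z x + ?r * (m' x * p_top x) + ?l * (m' x * p_bot x))"
    unfolding hat_eq by (simp add: algebra_simps)
  note ints = Lm_integrable_lborel[OF z] p_top_integrable p_bot_integrable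
  show int: "integrable lborel (\<lambda>x. m' x * hat z x)"
    unfolding eq by (intro Bochner_Integration.integrable_add integrable_mult_right ints)
  let ?b = "\<lambda>x. \<bar>m' x * tilde z x\<bar> + \<bar>?r\<bar> * \<bar>m' x * p_top x\<bar> + \<bar>?l\<bar> * \<bar>m' x * p_bot x\<bar>"
  have ib: "integrable lborel ?b"
    by (intro Bochner_Integration.integrable_add integrable_mult_right integrable_abs ints)
  have "(LINT x|lborel. \<bar>m' x * hat z x\<bar>) \<le> (LINT x|lborel. ?b x)"
  proof (rule integral_mono[OF integrable_abs[OF int] ib])
    fix x
    have "m' x * hat z x = m' x * tilde z x + ?r * (m' x * p_top x) + ?l * (m' x * p_bot x)"
      using eq by meson
    then show "\<bar>m' x * hat z x\<bar> \<le> ?b x"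
      using abs_triangle_ineq[of "m' x * tilde z x + ?r * (m' x * p_top x)" "?l * (m' x * p_bot x)"]
        abs_triangle_ineq[of "m' x * tilde z x" "?r * (m' x * p_top x)"]
      unfolding abs_mult[of ?r] abs_mult[of ?l] by linarith
  qed
  also have "\<dots> = (LINT x|lborel. \<bar>m' x * tilde z x\<bar>) + \<bar>?r\<bar> * (LINT x|lborel. \<bar>m' x * p_top x\<bar>) +
      \<bar>?l\<bar> * (LINT x|lborel. \<bar>m' x * p_bot x\<bar>)"
    using ints by (simp add: integrable_abs)
  also have "\<dots> \<le> Lm_norm m z + Lm_norm m z * (LINT x|lborel. \<bar>m' x * p_top x\<bar>) +
      Lm_norm m z * (LINT x|lborel. \<bar>m' x * p_bot x\<bar>)"
    using Lim_le_Lm_norm[OF z] Lm_integral_le[OF z] by (intro add_mono mult_right_mono) auto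
  also have "\<dots> = C * Lm_norm m z" by (simp add: C_def algebra_simps)
  finally show "(LINT x|lborel. \<bar>m' x * hat z x\<bar>) \<le> C * Lm_norm m z" .
qed

lemma hat_measurable: "z \<in> borel_measurable borel \<Longrightarrow> hat z \<in> borel_measurable borel"
proof -
  have "(\<lambda>x. ramp (- x)) \<in> borel_measurable borel" by measurable
  then show ?thesis if "z \<in> borel_measurable borel"
    unfolding hat_def using that
    by (intro borel_measurable_diff borel_measurable_times borel_measurable_const ramp_measurable)
qed

lemma hat_linear:
  assumes "g \<in> Lm m" "h \<in> Lm m"
  shows "hat (\<lambda>x. a * g x + b * h x) x = a * hat g x + b * hat h x"
  unfolding hat_def Lim_linear[OF assms] by (simp add: algebra_simps)

lemma hat_isCont: "continuous_on UNIV z \<Longrightarrow> isCont (hat z) x"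
  using continuous_on_compose[of UNIV uminus ramp] continuous_ramp
  unfolding hat_def
  by (intro continuous_intros) (auto simp: continuous_on_eq_continuous_at o_def)

lemma hat_eq_self:
  assumes "(z \<longlongrightarrow> 0) at_bot" "(z \<longlongrightarrow> 0) at_top"
  shows "hat z = z"
  using tendsto_Lim[OF _ assms(1)] tendsto_Lim[OF _ assms(2)] by (simp add: hat_def fun_eq_iff)

section \<open>The derivative as a bounded linear map into \<open>BB\<close>\<close>

lemma smooth_measurable [measurable]: "smooth_points \<in> sets borel"
  using open_smooth_points by auto

text \<open>Up to a null set \<kappa> is \<open>\<kappa>\<^sub>0\<close>, and the substitution sees
  y on the smooth points only, hence an inequality.\<close>

lemma \<kappa>_integral:
  assumes [measurable]: "y \<in> borel_measurable borel" and int: "integrable lborel y"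
  shows "integrable lborel (\<lambda>u. \<kappa> u * y (Q u))"
    and "(LINT u|lborel. \<bar>\<kappa> u * y (Q u)\<bar>) \<le> (LINT x|lborel. \<bar>y x\<bar>)"
proof -
  have i0: "integrable lborel (\<lambda>u. \<kappa>\<^sub>0 u * y (Q u))"
    using integrable_mult_indicator[OF _ int, of smooth_points]
    by (subst quantile_change_of_variables(1)) auto
  show "integrable lborel (\<lambda>u. \<kappa> u * y (Q u))"
    by (subst integrable_cong_AE[where g="\<lambda>u. \<kappa>\<^sub>0 u * y (Q u)"])
      (use i0 AE_\<kappa>_eq_\<kappa>\<^sub>0 \<kappa>_comp_quantile_measurable[of y] \<kappa>\<^sub>0_comp_quantile_measurable[of y] in auto)
  have abs: "integrable lborel (\<lambda>u. \<kappa>\<^sub>0 u * \<bar>y (Q u)\<bar>)"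
    using integrable_abs[OF i0] \<kappa>\<^sub>0_nonneg by (simp add: abs_mult)
  have "(LINT u|lborel. \<bar>\<kappa> u * y (Q u)\<bar>) = (LINT u|lborel. \<kappa>\<^sub>0 u * \<bar>y (Q u)\<bar>)"
  proof (rule integral_cong_AE)
    show "(\<lambda>u. \<bar>\<kappa> u * y (Q u)\<bar>) \<in> borel_measurable lborel"
      using borel_measurable_abs[OF \<kappa>_comp_quantile_measurable[of y]] by simp
    show "(\<lambda>u. \<kappa>\<^sub>0 u * \<bar>y (Q u)\<bar>) \<in> borel_measurable lborel"
      using \<kappa>\<^sub>0_comp_quantile_measurable[of "\<lambda>x. \<bar>y x\<bar>"] by simp
    show "AE u in lborel. \<bar>\<kappa> u * y (Q u)\<bar> = \<kappa>\<^sub>0 u * \<bar>y (Q u)\<bar>"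
      using AE_\<kappa>_eq_\<kappa>\<^sub>0 by eventually_elim (simp add: abs_mult \<kappa>\<^sub>0_nonneg)
  qed
  also have "\<dots> = (LINT x|lborel. indicator smooth_points x * \<bar>y x\<bar>)"
    using quantile_change_of_variables(2)[of "\<lambda>x. \<bar>y x\<bar>"] abs by simp
  also have "\<dots> \<le> (LINT x|lborel. \<bar>y x\<bar>)"
    by (rule integral_mono)
      (use integrable_mult_indicator[OF _ integrable_abs[OF int], of smooth_points] integrable_abs[OF int]
        in \<open>auto split: split_indicator\<close>)
  finally show "(LINT u|lborel. \<bar>\<kappa> u * y (Q u)\<bar>) \<le> (LINT x|lborel. \<bar>y x\<bar>)" .
qed

lemma D_outside: "u \<notin> {0<..<1} \<Longrightarrow> D z u = 0"
  by (auto simp: D_def \<kappa>_def)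

lemma D_integrable:
  assumes "z \<in> Lm m"
  shows "integrable lborel (D z)"
proof -
  note [measurable] = hat_measurable[OF Lm_measurable[OF assms]]
  have "integrable lborel (\<lambda>u. \<kappa> u * (m' (Q u) * hat z (Q u)))"
    by (rule \<kappa>_integral(1)[of "\<lambda>x. m' x * hat z x"]) (simp_all add: hat_integrable[OF assms])
  then show ?thesis unfolding D_def by simp
qed

lemma D_bounded:
  assumes "z \<in> Lm m"
  shows "BB_norm (D z) \<le> C * Lm_norm m z"
proof -
  note [measurable] = hat_measurable[OF Lm_measurable[OF assms]]
  have "BB_norm (D z) = (LINT u|lborel. \<bar>\<kappa> u * (m' (Q u) * hat z (Q u))\<bar>)"
    by (subst BB_norm_eq[OF D_outside]) (simp_all add: D_def)
  also have "\<dots> \<le> (LINT x|lborel. \<bar>m' x * hat z x\<bar>)"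
    by (rule \<kappa>_integral(2)[of "\<lambda>x. m' x * hat z x"]) (simp_all add: hat_integrable[OF assms])
  also have "\<dots> \<le> C * Lm_norm m z" by (rule hat_integrable(2)[OF assms])
  finally show ?thesis .
qed

lemma D_in_BB:
  assumes z: "z \<in> Lm_0 m"
  shows "D z \<in> BB"
  unfolding BB_def
proof (intro CollectI conjI ballI)
  show "\<forall>u. u \<notin> {0<..<1} \<longrightarrow> D z u = 0" using D_outside by blast
  show "set_integrable lborel {0<..<1} (D z)"
    using D_integrable z by (subst set_integrable_unit_iff[OF D_outside]) (auto simp: Lm_0_def)
  have cont: "isCont (\<lambda>x. m' x * hat z x) x" for x
    using z m'_isCont hat_isCont by (intro continuous_intros) (auto simp: Lm_0_def)
  fix u :: real assume "u \<in> {0<..<1}"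
  then have u: "0 < u" "u < 1" by auto
  have "((\<lambda>v. - (\<kappa> v * (m' (Q v) * hat z (Q v)))) \<longlongrightarrow> - (\<kappa> u * (m' (Q u) * hat z (Q u)))) (at_left u)"
    by (intro tendsto_minus tendsto_mult[OF \<kappa>_left_cont[OF u]]
        isCont_tendsto_compose[OF cont quantile_tendsto_left[OF u]])
  then show "(D z \<longlongrightarrow> D z u) (at_left u)" by (simp add: D_def[abs_def])
  from quantile_right_limit[OF u] \<kappa>_right_limit[OF u] obtain x l
    where x: "(Q \<longlongrightarrow> x) (at_right u)" and l: "(\<kappa> \<longlongrightarrow> l) (at_right u)" by blast
  have "((\<lambda>v. - (\<kappa> v * (m' (Q v) * hat z (Q v)))) \<longlongrightarrow> - (l * (m' x * hat z x))) (at_right u)"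
    by (intro tendsto_minus tendsto_mult[OF l] isCont_tendsto_compose[OF cont x])
  then show "\<exists>l. (D z \<longlongrightarrow> l) (at_right u)" unfolding D_def by blast
qed

lemma D_linear:
  assumes "g \<in> Lm m" "h \<in> Lm m"
  shows "D (\<lambda>x. a * g x + b * h x) = (\<lambda>u. a * D g u + b * D h u)"
  unfolding D_def hat_linear[OF assms] by (simp add: algebra_simps)

lemma D_continuous:
  assumes g: "\<And>n. g n \<in> Lm m" and h: "h \<in> Lm m"
    and lim: "(\<lambda>n. Lm_norm m (\<lambda>x. g n x - h x)) \<longlonglongrightarrow> 0"
  shows "(\<lambda>n. BB_norm (\<lambda>u. D (g n) u - D h u)) \<longlonglongrightarrow> 0"
proof (rule Lim_null_comparison)
  show "(\<lambda>n. C * Lm_norm m (\<lambda>x. g n x - h x)) \<longlonglongrightarrow> 0"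
    using tendsto_mult[OF tendsto_const lim] by simp
  show "eventually (\<lambda>n. norm (BB_norm (\<lambda>u. D (g n) u - D h u)) \<le> C * Lm_norm m (\<lambda>x. g n x - h x)) sequentially"
  proof (intro always_eventually allI)
    fix n
    have "(\<lambda>u. D (g n) u - D h u) = D (\<lambda>x. g n x - h x)"
      using D_linear[OF g[of n] h, of 1 "-1"] by simp
    moreover have "0 \<le> BB_norm (D (\<lambda>x. g n x - h x))"
      by (subst BB_norm_eq[OF D_outside]) simp_all
    ultimately show "norm (BB_norm (\<lambda>u. D (g n) u - D h u)) \<le> C * Lm_norm m (\<lambda>x. g n x - h x)"
      using D_bounded[OF Lm_diff[OF g h, of n]] by simp
  qed
qed

section \<open>Agreement of \<open>D\<close> with the explicit formula\<close>

lemma deriv_expr_eq: "deriv_expr F f m' z u = - (\<kappa>\<^sub>0 u * (m' (Q u) * z (Q u)))"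
  by (auto simp: deriv_expr_def \<kappa>\<^sub>0_def)

lemma AE_smooth_eq:
  assumes "\<And>x. x \<notin> I \<Longrightarrow> z x = 0"
  shows "AE x in lborel. indicator smooth_points x * (m' x * z x) = m' x * z x"
  using AE_I_imp_smooth by eventually_elim (use assms in \<open>auto split: split_indicator\<close>)

text \<open>The substitution restricts m' z to the smooth points; since z vanishes off I, this
  changes it on a null set only.\<close>

lemma deriv_expr_integrable_iff:
  assumes z: "z \<in> Lm m" "\<And>x. x \<notin> I \<Longrightarrow> z x = 0"
  shows "set_integrable lborel {0<..<1} (deriv_expr F f m' z) \<longleftrightarrow> integrable lborel (\<lambda>x. m' x * z x)"
proof -
  note [measurable] = Lm_measurable[OF z(1)]
  have "set_integrable lborel {0<..<1} (deriv_expr F f m' z) \<longleftrightarrow> integrable lborel (deriv_expr F f m' z)"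
    by (rule set_integrable_unit_iff) (auto simp: deriv_expr_def)
  also have "\<dots> \<longleftrightarrow> integrable lborel (\<lambda>u. \<kappa>\<^sub>0 u * (m' (Q u) * z (Q u)))"
    unfolding deriv_expr_eq[abs_def] by simp
  also have "\<dots> \<longleftrightarrow> integrable lborel (\<lambda>x. indicator smooth_points x * (m' x * z x))"
    by (rule quantile_change_of_variables(1)[of "\<lambda>x. m' x * z x"]) simp
  also have "\<dots> \<longleftrightarrow> integrable lborel (\<lambda>x. m' x * z x)"
    by (rule integrable_cong_AE[OF _ _ AE_smooth_eq]) (auto simp: z(2))
  finally show ?thesis .
qed

text \<open>On A outside [a, b] the modulus of m' is at most |m' z| / c, and on [a, b] continuity
  makes m' integrable.\<close>

lemma integrable_m'_tail:
  assumes [measurable]: "z \<in> borel_measurable borel" "A \<in> sets borel"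
    and int: "integrable lborel (\<lambda>x. m' x * z x)" and c: "0 < c"
    and tail: "\<And>x. x \<in> A \<Longrightarrow> x \<notin> {a..b} \<Longrightarrow> c \<le> \<bar>z x\<bar>"
  shows "integrable lborel (\<lambda>x. indicator A x * m' x)"
proof (rule Bochner_Integration.integrable_bound)
  show "integrable lborel (\<lambda>x. \<bar>indicator {a..b} x * m' x\<bar> + \<bar>m' x * z x\<bar> / c)"
    using integrable_m'_compact[of a b] int
    by (intro Bochner_Integration.integrable_add integrable_abs integrable_divide) auto
  show "AE x in lborel. norm (indicator A x * m' x) \<le> norm (\<bar>indicator {a..b} x * m' x\<bar> + \<bar>m' x * z x\<bar> / c)"
  proof (intro always_eventually allI)
    fix x
    have "\<bar>m' x\<bar> \<le> \<bar>m' x * z x\<bar> / c" if "x \<in> A" "x \<notin> {a..b}"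
      using mult_left_mono[OF tail[OF that], of "\<bar>m' x\<bar>"] c by (simp add: field_simps abs_mult)
    then show "norm (indicator A x * m' x) \<le> norm (\<bar>indicator {a..b} x * m' x\<bar> + \<bar>m' x * z x\<bar> / c)"
      using c by (cases "x \<in> {a..b}"; cases "x \<in> A") auto
  qed
qed simp

text \<open>A nonzero limit keeps |z| above half its modulus near that end, so integrability of m' z
  passes to m' there and the corresponding switch \<open>c_top\<close> or \<open>c_bot\<close> is 0.
  Hence \<open>hat z = z\<close> whenever the formula is integrable.\<close>

lemma c_limits_eq_0:
  assumes z: "z \<in> Lm m" and int: "integrable lborel (\<lambda>x. m' x * z x)"
  shows "c_top * Lim at_top z = 0" and "c_bot * Lim at_bot z = 0"
proof -
  show "c_top * Lim at_top z = 0"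
  proof (cases "Lim at_top z = 0")
    case False
    then have pos: "\<bar>Lim at_top z\<bar> / 2 < \<bar>Lim at_top z\<bar>" by simp
    from order_tendstoD(1)[OF tendsto_rabs[OF Lm_tendsto(2)[OF z]] pos] obtain N
      where N: "\<And>x. N \<le> x \<Longrightarrow> \<bar>Lim at_top z\<bar> / 2 < \<bar>z x\<bar>"
      by (auto simp: eventually_at_top_linorder)
    have "integrable lborel (\<lambda>x. indicator {0..} x * m' x)"
      by (rule integrable_m'_tail[OF Lm_measurable[OF z] _ int, of _ "\<bar>Lim at_top z\<bar> / 2" 0 N])
        (use False N in \<open>auto intro!: less_imp_le\<close>)
    then show ?thesis by (simp add: c_top_def)
  qed simp
  show "c_bot * Lim at_bot z = 0"
  proof (cases "Lim at_bot z = 0")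
    case False
    then have pos: "\<bar>Lim at_bot z\<bar> / 2 < \<bar>Lim at_bot z\<bar>" by simp
    from order_tendstoD(1)[OF tendsto_rabs[OF Lm_tendsto(1)[OF z]] pos] obtain N
      where N: "\<And>x. x \<le> N \<Longrightarrow> \<bar>Lim at_bot z\<bar> / 2 < \<bar>z x\<bar>"
      by (auto simp: eventually_at_bot_linorder)
    have "integrable lborel (\<lambda>x. indicator {..<0} x * m' x)"
      by (rule integrable_m'_tail[OF Lm_measurable[OF z] _ int, of _ "\<bar>Lim at_bot z\<bar> / 2" N 0])
        (use False N in \<open>auto intro!: less_imp_le\<close>)
    then show ?thesis by (simp add: c_bot_def)
  qed simp
qed

lemma D_eq_deriv_expr:
  assumes z: "z \<in> Lm m" "\<And>x. x \<notin> I \<Longrightarrow> z x = 0"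
    and int: "set_integrable lborel {0<..<1} (deriv_expr F f m' z)"
  shows "AE u in lborel. D z u = deriv_expr F f m' z u"
proof -
  have "integrable lborel (\<lambda>x. m' x * z x)"
    using int deriv_expr_integrable_iff[OF z] by simp
  then have hat: "hat z = z"
    unfolding hat_def[abs_def] by (simp only: c_limits_eq_0[OF z(1)]) simp
  show ?thesis
    using AE_\<kappa>_eq_\<kappa>\<^sub>0 by eventually_elim (simp add: D_def deriv_expr_eq hat)
qed

lemma deriv_expr_integrable:
  assumes z: "z \<in> Lm m" "\<And>x. x \<notin> I \<Longrightarrow> z x = 0" and "(z \<longlongrightarrow> 0) at_bot" "(z \<longlongrightarrow> 0) at_top"
  shows "set_integrable lborel {0<..<1} (deriv_expr F f m' z)"
  using deriv_expr_integrable_iff[OF z] Lm_integrable_lborel[OF z(1)] tilde_eq[OF assms(3,4)] by simp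

section \<open>Convergence of the difference quotients\<close>

lemma hadamard_limit:
  assumes h: "h \<in> Lm_0 m" "\<And>x. x \<notin> I \<Longrightarrow> h x = 0"
    and t: "\<And>n. t n \<noteq> 0" "t \<longlonglongrightarrow> 0" and g: "\<And>n. g n \<in> Lm m"
    and lim: "(\<lambda>n. Lm_norm m (\<lambda>x. g n x - h x)) \<longlonglongrightarrow> 0"
    and Fn: "\<And>n. (\<lambda>x. F x + t n * g n x) \<in> Lm_phi m"
  shows "(\<lambda>n. BB_norm (\<lambda>u. (phi_psi m (\<lambda>x. F x + t n * g n x) u - phi_psi m F u) / t n - D h u)) \<longlonglongrightarrow> 0"
proof -
  define e where "e n = Lm_norm m (\<lambda>x. g n x - h x)" for n
  define G where "G n = (\<lambda>x. F x + t n * g n x)" for n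
  define X where "X n u = (phi_psi m (G n) u - phi_psi m F u) / t n" for n u
  define Y where "Y n u = indicator {0<..<1} u * \<bar>W (quantile (G n) u) - W (Q u)\<bar> / \<bar>t n\<bar>" for n u
  define Y' where "Y' u = \<kappa>\<^sub>0 u * \<bar>m' (Q u) * h (Q u)\<bar>" for u
  have h_Lm: "h \<in> Lm m" and h_cont: "continuous_on UNIV h" using h(1) by (auto simp: Lm_0_def)
  note [measurable] = Lm_measurable[OF h_Lm] Lm_measurable[OF g]
  have e_lim: "e \<longlonglongrightarrow> 0" using lim by (simp add: e_def[abs_def])
  have close: "\<bar>g n x - h x\<bar> \<le> e n" for n x
    using abs_le_Lm_norm[OF Lm_diff[OF g h_Lm]] by (simp add: e_def)
  have G: "distribution_function (G n)" for n
    unfolding G_def by (rule Lm_phi_distribution_function[OF Fn])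
  have Fdf: "distribution_function F" by (rule distribution_function_axioms)
  \<comment> \<open>F and \<open>G n\<close> share the limits 0 and 1, so \<open>g n\<close>
    vanishes at both ends, and so does its uniform limit h. Hence \<open>tilde\<close> leaves both
    unchanged and \<open>hat h = h\<close>.\<close>
  have g0: "(g n \<longlongrightarrow> 0) at_bot" "(g n \<longlongrightarrow> 0) at_top" for n
  proof -
    interpret G: distribution_function "G n" by (rule G)
    have eq: "g n = (\<lambda>x. (G n x - F x) / t n)" using t(1)[of n] by (simp add: G_def fun_eq_iff)
    have "((\<lambda>x. (G n x - F x) / t n) \<longlongrightarrow> (0 - 0) / t n) at_bot"
      using t(1)[of n] by (intro tendsto_intros G.F_bot F_bot)
    then show "(g n \<longlongrightarrow> 0) at_bot" unfolding eq[symmetric] by simp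
    have "((\<lambda>x. (G n x - F x) / t n) \<longlongrightarrow> (1 - 1) / t n) at_top"
      using t(1)[of n] by (intro tendsto_intros G.F_top F_top)
    then show "(g n \<longlongrightarrow> 0) at_top" unfolding eq[symmetric] by simp
  qed
  have h0: "(h \<longlongrightarrow> 0) at_bot" "(h \<longlongrightarrow> 0) at_top"
    by (rule uniform_limit_zero_limits[OF g0(1) close e_lim] uniform_limit_zero_limits[OF g0(2) close e_lim])+
  have hat_h: "hat h = h" using hat_eq_self[OF h0] .
  have int_h: "integrable lborel (\<lambda>x. m' x * h x)"
    using Lm_integrable_lborel[OF h_Lm] by (simp add: tilde_eq[OF h0])
  have int_g: "integrable lborel (\<lambda>x. m' x * g n x)" for n
    using Lm_integrable_lborel[OF g] by (simp add: tilde_eq[OF g0])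
  have int_G: "integrable lborel (\<lambda>x. m' x * (G n x - F x))" for n
    using integrable_mult_right[OF int_g, of "t n" n] by (simp add: G_def mult_ac)

  have Y_int: "integrable lborel (Y n)" for n
    unfolding Y_def by (intro integrable_divide W_quantile_difference(1) Fdf G int_G)
  have Y_val: "(LINT u|lborel. Y n u) = (LINT x|lborel. \<bar>m' x * g n x\<bar>)" for n
  proof -
    have "(LINT u|lborel. Y n u) = (LINT x|lborel. \<bar>m' x * (G n x - F x)\<bar>) / \<bar>t n\<bar>"
      unfolding Y_def by (simp add: W_quantile_difference(2)[OF Fdf G int_G])
    also have "\<dots> = (LINT x|lborel. \<bar>t n\<bar> * \<bar>m' x * g n x\<bar>) / \<bar>t n\<bar>"
      by (simp add: G_def abs_mult mult_ac)
    also have "\<dots> = (LINT x|lborel. \<bar>m' x * g n x\<bar>)"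
      using t(1)[of n] int_g[of n] by (simp add: integrable_abs)
    finally show ?thesis .
  qed
  have int_sm: "integrable lborel (\<lambda>x. indicator smooth_points x * \<bar>m' x * h x\<bar>)"
    using integrable_mult_indicator[OF _ integrable_abs[OF int_h], of smooth_points] by simp
  have Y'_int: "integrable lborel Y'"
    unfolding Y'_def using quantile_change_of_variables(1)[of "\<lambda>x. \<bar>m' x * h x\<bar>"] int_sm by simp
  have Y'_val: "(LINT u|lborel. Y' u) = (LINT x|lborel. \<bar>m' x * h x\<bar>)"
  proof -
    have "(LINT u|lborel. Y' u) = (LINT x|lborel. indicator smooth_points x * \<bar>m' x * h x\<bar>)"
      using Y'_int quantile_change_of_variables(2)[of "\<lambda>x. \<bar>m' x * h x\<bar>"]
      by (simp add: Y'_def[abs_def])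
    also have "\<dots> = (LINT x|lborel. \<bar>m' x * h x\<bar>)"
    proof (rule integral_cong_AE)
      show "AE x in lborel. indicator smooth_points x * \<bar>m' x * h x\<bar> = \<bar>m' x * h x\<bar>"
        using AE_I_imp_smooth by eventually_elim (use h(2) in \<open>auto split: split_indicator\<close>)
    qed auto
    finally show ?thesis .
  qed
  \<comment> \<open>Both sides are now weighted integrals of |g n| and |h|, and the second component
    of the norm bounds their difference by \<open>e n\<close>.\<close>
  have int_lim: "(\<lambda>n. LINT u|lborel. Y n u) \<longlonglongrightarrow> (LINT u|lborel. Y' u)"
    unfolding Y_val Y'_val
  proof (rule LIM_zero_cancel, rule Lim_null_comparison[OF _ e_lim], intro always_eventually allI)
    fix n
    have d0: "((\<lambda>x. g n x - h x) \<longlongrightarrow> 0) at_bot" "((\<lambda>x. g n x - h x) \<longlongrightarrow> 0) at_top"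
      using tendsto_diff[OF g0(1) h0(1)] tendsto_diff[OF g0(2) h0(2)] by auto
    have "norm ((LINT x|lborel. \<bar>m' x * g n x\<bar>) - (LINT x|lborel. \<bar>m' x * h x\<bar>)) =
        norm (LINT x|lborel. \<bar>m' x * g n x\<bar> - \<bar>m' x * h x\<bar>)"
      using int_g int_h by (subst Bochner_Integration.integral_diff) (auto intro: integrable_abs)
    also have "\<dots> \<le> (LINT x|lborel. norm (\<bar>m' x * g n x\<bar> - \<bar>m' x * h x\<bar>))"
      by (rule integral_norm_bound)
    also have "\<dots> \<le> (LINT x|lborel. \<bar>m' x * (g n x - h x)\<bar>)"
    proof (rule integral_mono)
      show "integrable lborel (\<lambda>x. norm (\<bar>m' x * g n x\<bar> - \<bar>m' x * h x\<bar>))"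
        using int_g int_h by (intro integrable_norm Bochner_Integration.integrable_diff integrable_abs)
      show "integrable lborel (\<lambda>x. \<bar>m' x * (g n x - h x)\<bar>)"
        using int_g int_h unfolding right_diff_distrib
        by (intro integrable_abs Bochner_Integration.integrable_diff)
      show "norm (\<bar>m' x * g n x\<bar> - \<bar>m' x * h x\<bar>) \<le> \<bar>m' x * (g n x - h x)\<bar>" for x
        using abs_triangle_ineq3[of "m' x * g n x" "m' x * h x"] by (simp add: right_diff_distrib)
    qed
    also have "\<dots> \<le> e n"
      using Lm_integral_le[OF Lm_diff[OF g h_Lm, of n]] unfolding tilde_eq[OF d0] e_def .
    finally show "norm ((LINT x|lborel. \<bar>m' x * g n x\<bar>) - (LINT x|lborel. \<bar>m' x * h x\<bar>)) \<le> e n" .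
  qed

  have bound: "\<bar>X n u\<bar> \<le> Y n u" for n u
  proof (cases "u \<in> {0<..<1}")
    case True
    then have "\<bar>X n u\<bar> = \<bar>m (quantile (G n) u) - m (Q u)\<bar> / \<bar>t n\<bar>"
      by (simp add: X_def phi_psi_def abs_divide)
    also have "\<dots> \<le> \<bar>W (quantile (G n) u) - W (Q u)\<bar> / \<bar>t n\<bar>"
      by (intro divide_right_mono m_diff_le_W) simp
    finally show ?thesis using True by (simp add: Y_def)
  qed (auto simp: X_def Y_def phi_psi_def)

  have limits: "(\<lambda>n. X n u) \<longlonglongrightarrow> D h u \<and> (\<lambda>n. Y n u) \<longlonglongrightarrow> Y' u" if nb: "u \<notin> jump_bounds" for u
  proof (cases "0 < u \<and> u < 1")
    case False
    then show ?thesis by (auto simp: X_def Y_def Y'_def D_def \<kappa>_def \<kappa>\<^sub>0_def phi_psi_def)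
  next
    case True
    then have u: "0 < u" "u < 1" by auto
    show ?thesis
    proof (cases "isCont F (Q u)")
      case cont: True
      define q where "q n = quantile (G n) u" for n
      have sm: "Q u \<in> smooth_points" by (rule quantile_smooth[OF u cont])
      have FQ: "F (Q u) = u" by (rule F_quantile_isCont[OF u cont])
      have nhds: "eventually (\<lambda>y. isCont F y) (nhds (Q u))"
        using eventually_smooth[OF sm] by eventually_elim (simp add: smooth_points_def)
      note pert = quantile_perturbation_derivative[OF G[unfolded G_def] t close e_lim h_cont
          smooth_deriv[OF sm] smooth_pos[OF sm] nhds, unfolded FQ, OF u]
      have q: "q \<longlonglongrightarrow> Q u" "(\<lambda>n. (q n - Q u) / t n) \<longlonglongrightarrow> - h (Q u) / f (Q u)"
        using pert by (simp_all add: q_def[abs_def] G_def)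
      have "(\<lambda>n. (m (q n) - m (Q u)) / t n) \<longlonglongrightarrow> m' (Q u) * (- h (Q u) / f (Q u))"
        by (rule DERIV_along_sequence[OF m_deriv q])
      moreover have "D h u = m' (Q u) * (- h (Q u) / f (Q u))"
        using u cont by (simp add: D_def hat_h \<kappa>_eq_\<kappa>\<^sub>0[OF nb] \<kappa>\<^sub>0_def)
      moreover have "X n u = (m (q n) - m (Q u)) / t n" for n
        using u by (simp add: X_def phi_psi_def q_def)
      ultimately have 1: "(\<lambda>n. X n u) \<longlonglongrightarrow> D h u" by simp
      have "(\<lambda>n. \<bar>(W (q n) - W (Q u)) / t n\<bar>) \<longlonglongrightarrow> \<bar>\<bar>m' (Q u)\<bar> * (- h (Q u) / f (Q u))\<bar>"
        by (rule tendsto_rabs[OF DERIV_along_sequence[OF W q]])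
      moreover have "Y' u = \<bar>\<bar>m' (Q u)\<bar> * (- h (Q u) / f (Q u))\<bar>"
        using u cont smooth_pos[OF sm] by (simp add: Y'_def \<kappa>\<^sub>0_def abs_mult abs_divide)
      moreover have "Y n u = \<bar>(W (q n) - W (Q u)) / t n\<bar>" for n
        using u by (simp add: Y_def q_def abs_divide)
      ultimately have 2: "(\<lambda>n. Y n u) \<longlonglongrightarrow> Y' u" by simp
      from 1 2 show ?thesis ..
    next
      case jump: False
      \<comment> \<open>Being off \<open>jump_bounds\<close> places u strictly between F(x-) and
        F(x) for the jump x = \<open>Q u\<close>, which gives both gaps needed for a locally fixed
        quantile.\<close>
      have "\<exists>l<u. \<forall>y<Q u. F y \<le> l" "F (Q u) \<noteq> u"
        using nb u jump by (auto simp: jump_bounds_def) (meson not_le)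
      then obtain l where l: "\<And>y. y < Q u \<Longrightarrow> F y \<le> l" "l < u" and ne: "u < F (Q u)"
        using le_F_quantile[OF u] by force
      have G_close: "\<bar>G n y - F y\<bar> \<le> \<bar>t n\<bar> * (e n + Lm_norm m h)" for n y
      proof -
        have "\<bar>g n y\<bar> \<le> e n + Lm_norm m h"
          using close[of n y] abs_le_Lm_norm[OF h_Lm, of y] by linarith
        then show ?thesis by (simp add: G_def abs_mult mult_left_mono)
      qed
      have "(\<lambda>n. \<bar>t n\<bar> * (e n + Lm_norm m h)) \<longlonglongrightarrow> \<bar>0\<bar> * (0 + Lm_norm m h)"
        by (intro tendsto_intros t e_lim)
      then have d_lim: "(\<lambda>n. \<bar>t n\<bar> * (e n + Lm_norm m h)) \<longlonglongrightarrow> 0" by simp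
      have ev: "eventually (\<lambda>n. quantile (G n) u = Q u) sequentially"
        by (rule quantile_perturbation_at_jump[OF G G_close d_lim u l ne])
      have "D h u = 0" "Y' u = 0"
        using jump by (simp_all add: D_def Y'_def \<kappa>_eq_\<kappa>\<^sub>0[OF nb] \<kappa>\<^sub>0_def)
      moreover have "eventually (\<lambda>n. X n u = 0) sequentially"
        using ev by eventually_elim (simp add: X_def phi_psi_def)
      moreover have "eventually (\<lambda>n. Y n u = 0) sequentially"
        using ev by eventually_elim (simp add: Y_def)
      ultimately show ?thesis by (simp add: tendsto_eventually)
    qed
  qed
  have AE_limits: "AE u in lborel. (\<lambda>n. X n u) \<longlonglongrightarrow> D h u \<and> (\<lambda>n. Y n u) \<longlonglongrightarrow> Y' u"
    using AE_not_jump_bounds by eventually_elim (rule limits)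

  have "(\<lambda>n. LINT u|lborel. \<bar>X n u - D h u\<bar>) \<longlonglongrightarrow> 0"
  proof (rule dominated_convergence_varying_bound[OF _ _ Y_int Y'_int _ _ _ int_lim])
    show "X n \<in> borel_measurable lborel" for n
      unfolding X_def using phi_psi_measurable[OF G, of n] phi_psi_measurable[OF Fdf] by measurable
    show "D h \<in> borel_measurable lborel" using D_integrable[OF h_Lm] by (rule borel_measurable_integrable)
    show "AE u in lborel. \<bar>X n u\<bar> \<le> Y n u" for n using bound by simp
    show "AE u in lborel. (\<lambda>n. X n u) \<longlonglongrightarrow> D h u" "AE u in lborel. (\<lambda>n. Y n u) \<longlonglongrightarrow> Y' u"
      using AE_limits by (eventually_elim, simp)+
  qed
  moreover have "BB_norm (\<lambda>u. X n u - D h u) = (LINT u|lborel. \<bar>X n u - D h u\<bar>)" for n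
    by (rule BB_norm_eq) (use D_outside in \<open>auto simp: X_def phi_psi_def\<close>)
  ultimately show ?thesis by (simp add: X_def G_def)
qed

lemma has_hadamard_derivative_D:
  "has_hadamard_derivative (Lm m) (Lm_norm m) BB BB_norm (Lm_phi m) (phi_psi m) F
     {z \<in> Lm_0 m. \<forall>x. x \<notin> I \<longrightarrow> z x = 0} D"
  unfolding has_hadamard_derivative_def
proof (intro conjI ballI allI impI)
  show "Lm_phi m \<subseteq> Lm m" using Lm_phi_imp_Lm by blast
  show "F \<in> Lm_phi m" by (rule F_Lm_phi)
  show "{z \<in> Lm_0 m. \<forall>x. x \<notin> I \<longrightarrow> z x = 0} \<subseteq> Lm m" by (auto simp: Lm_0_def)
  show "phi_psi m \<in> Lm_phi m \<rightarrow> BB" using phi_psi_in_BB by blast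
  show "D \<in> {z \<in> Lm_0 m. \<forall>x. x \<notin> I \<longrightarrow> z x = 0} \<rightarrow> BB" using D_in_BB by blast
next
  fix g h a b
  assume "g \<in> {z \<in> Lm_0 m. \<forall>x. x \<notin> I \<longrightarrow> z x = 0}" "h \<in> {z \<in> Lm_0 m. \<forall>x. x \<notin> I \<longrightarrow> z x = 0}"
  then show "D (\<lambda>x. a * g x + b * h x) = (\<lambda>u. a * D g u + b * D h u)"
    by (intro D_linear) (auto simp: Lm_0_def)
next
  fix h g
  assume "h \<in> {z \<in> Lm_0 m. \<forall>x. x \<notin> I \<longrightarrow> z x = 0}"
    "(\<forall>n::nat. g n \<in> {z \<in> Lm_0 m. \<forall>x. x \<notin> I \<longrightarrow> z x = 0}) \<and> (\<lambda>n. Lm_norm m (\<lambda>x. g n x - h x)) \<longlonglongrightarrow> 0"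
  then show "(\<lambda>n. BB_norm (\<lambda>u. D (g n) u - D h u)) \<longlonglongrightarrow> 0"
    by (intro D_continuous) (auto simp: Lm_0_def)
next
  fix h t g
  assume h: "h \<in> {z \<in> Lm_0 m. \<forall>x. x \<notin> I \<longrightarrow> z x = 0}"
    and *: "(\<forall>n. t n \<noteq> 0) \<and> t \<longlonglongrightarrow> 0 \<and> (\<forall>n. g n \<in> Lm m) \<and> (\<lambda>n. Lm_norm m (\<lambda>x. g n x - h x)) \<longlonglongrightarrow> 0 \<and>
      (\<forall>n. (\<lambda>x. F x + t n * g n x) \<in> Lm_phi m)"
  show "(\<lambda>n. BB_norm (\<lambda>u. (phi_psi m (\<lambda>x. F x + t n * g n x) u - phi_psi m F u) / t n - D h u)) \<longlonglongrightarrow> 0"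
    by (rule hadamard_limit) (use h * in auto)
qed

end

theorem theorem4p1:
  fixes m m' F f :: "real \<Rightarrow> real" and I :: "real set"
  assumes m_deriv: "\<And>x. (m has_real_derivative m' x) (at x)"
    and m'_cont: "continuous_on UNIV m'"
    and F: "F \<in> Lm_phi m"
    and I: "is_interval I"
    and F_on_I: "AE x in interval_measure F. x \<in> I"
    and jumps: "finite {x. \<not> isCont F x}"
    and density: "\<And>x. x \<in> interior I \<Longrightarrow> isCont F x \<Longrightarrow> (F has_real_derivative f x) (at x)"
    and f_pos: "\<And>x. x \<in> interior I \<Longrightarrow> isCont F x \<Longrightarrow> 0 < f x"
    and f_cont: "continuous_on {x \<in> interior I. isCont F x} f"
    and f_left: "\<And>x. \<not> isCont F x \<Longrightarrow> \<exists>a\<in>I. a < x \<Longrightarrow> \<exists>l. ((\<lambda>y. 1 / f y) \<longlongrightarrow> l) (at_left x)"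
    and f_right: "\<And>x. \<not> isCont F x \<Longrightarrow> \<exists>b\<in>I. x < b \<Longrightarrow> \<exists>l. ((\<lambda>y. 1 / f y) \<longlongrightarrow> l) (at_right x)"
  defines "T \<equiv> {z \<in> Lm_0 m. \<forall>x. x \<notin> I \<longrightarrow> z x = 0}"
  shows "\<exists>D. has_hadamard_derivative (Lm m) (Lm_norm m) BB BB_norm (Lm_phi m) (phi_psi m) F T D \<and>
    (\<forall>z\<in>T. set_integrable lborel {0<..<1} (deriv_expr F f m' z) \<longrightarrow>
      (AE u in lborel. D z u = deriv_expr F f m' z u)) \<and>
    (\<forall>z\<in>T. (z \<longlongrightarrow> 0) at_bot \<and> (z \<longlongrightarrow> 0) at_top \<longrightarrow>
      set_integrable lborel {0<..<1} (deriv_expr F f m' z))"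
proof -
  interpret distribution_function F by (rule Lm_phi_distribution_function[OF F])
  interpret quantile_derivative m m' F I f
    by unfold_locales (fact assms)+
  have T: "z \<in> Lm m" "\<And>x. x \<notin> I \<Longrightarrow> z x = 0" if "z \<in> T" for z
    using that by (auto simp: T_def Lm_0_def)
  show ?thesis
  proof (intro exI[of _ D] conjI ballI impI)
    show "has_hadamard_derivative (Lm m) (Lm_norm m) BB BB_norm (Lm_phi m) (phi_psi m) F T D"
      unfolding T_def by (rule has_hadamard_derivative_D)
  next
    fix z assume "z \<in> T" "set_integrable lborel {0<..<1} (deriv_expr F f m' z)"
    then show "AE u in lborel. D z u = deriv_expr F f m' z u"
      using D_eq_deriv_expr T by blast
  next
    fix z assume "z \<in> T" "(z \<longlongrightarrow> 0) at_bot \<and> (z \<longlongrightarrow> 0) at_top"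
    then show "set_integrable lborel {0<..<1} (deriv_expr F f m' z)"
      using deriv_expr_integrable T by blast
  qed
qed

end
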